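(* Let $\mathbf{k}$ be a field and let $\mathbb{X}: X_1 \subset X_2 \subset \dots \subset X_n = X_\infty$ be a filtered cell complex. Then for all $k$, $$\mathrm{Pers}_0(\mathrm{H}_k(\mathbb{X})) = \mathrm{Pers}_0(\mathrm{H}_{k+1}(X_\infty, \mathbb{X})), \qquad \mathrm{Pers}_\infty(\mathrm{H}_k(\mathbb{X})) = \mathrm{Pers}_\infty(\mathrm{H}_{k}(X_\infty, \mathbb{X})),$$ where the second "equality" is interpreted as a bijection of multisets given by $[a,\infty)\leftrightarrow[-\infty,a)$ (in terms of index pairs, $[p,n]\leftrightarrow[0,p-1]$).
   Context: All homology is taken with coefficients in the fixed field $\mathbf{k}$. A filtered cell complex is a sequence of cell complexes $X_1 \subset X_2 \subset \dots \subset X_n = X_\infty$ where $X_1$ is a single vertex $\sigma_1$ and $X_i = X_{i-1}\cup\sigma_i$ is obtained from $X_{i-1}$ by adding a single cell $\sigma_i$. Real values $a_1\le a_2\le\dots\le a_n$ are attached to the indices. Convention: $X_0=\emptyset$. A persistence module is a finite sequence of finite-dimensional $\mathbf{k}$-vector spaces indexed by consecutive integers, with linear maps between consecutive terms. It decomposes as a direct sum of interval modules $[p,q]$ (one-dimensional at indices $p,\dots,q$ with identity maps between them, zero elsewhere). $\mathrm{Pers}$ of a persistence module is the multiset of the pairs $[p,q]$ occurring in such a decomposition. A pair $[p,q]$ is interpreted as the half-open interval $[a_p,a_{q+1})$, with $a_0=-\infty$, $a_{n+1}=\infty$. The persistence modules used, with maps induced by inclusions, are - $\mathrm{H}_k(\mathbb{X}):\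 \mathrm{H}_k(X_1)\to\dots\to \mathrm{H}_k(X_n)$, indexed by $1,\dots,n$; - $\mathrm{H}_k(X_\infty,\mathbb{X}):\ \mathrm{H}_k(X_n)\to \mathrm{H}_k(X_n,X_1)\to\dots\to \mathrm{H}_k(X_n,X_{n-1})$, indexed by $0,\dots,n-1$. Each persistence diagram is partitioned as $\mathrm{Pers}=\mathrm{Pers}_0\cup\mathrm{Pers}_\infty$, where $\mathrm{Pers}_0$ comprises the finite intervals $[a,b)$ and $\mathrm{Pers}_\infty$ the infinite intervals $[a,\infty)$ or $[-\infty,b)$. Thus for $\mathrm{H}_k(\mathbb{X})$ the infinite intervals are the pairs $[p,n]$, and for $\mathrm{H}_k(X_\infty,\mathbb{X})$ they are the pairs $[0,q]$. *)

theory Defs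
  imports
    "HOL-Homology.Homology"
    "HOL-Algebra.Module"
    "HOL-Library.Extended_Nat"
    "HOL-Library.Extended_Real"
    "HOL-Library.Poly_Mapping"
begin

section \<open>Filtered cell complexes\<close>

definition sqnorm :: "nat \<Rightarrow> (nat \<Rightarrow> real) \<Rightarrow> real" where
  "sqnorm d x = (\<Sum>i<d. (x i)\<^sup>2)"

definition closed_disk :: "nat \<Rightarrow> (nat \<Rightarrow> real) topology" where
  "closed_disk d = subtopology (Euclidean_space d) {x. sqnorm d x \<le> 1}"

text \<open>For \<open>d = 0\<close> the disk is a point, its interior is that point and its boundary sphere is empty.\<close>

definition disk_interior :: "nat \<Rightarrow> (nat \<Rightarrow> real) set" where
  "disk_interior d = {x \<in> topspace (closed_disk d). sqnorm d x < 1}"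

definition disk_boundary :: "nat \<Rightarrow> (nat \<Rightarrow> real) set" where
  "disk_boundary d = {x \<in> topspace (closed_disk d). sqnorm d x = 1}"

definition characteristic_map ::
  "'a topology \<Rightarrow> nat \<Rightarrow> 'a set \<Rightarrow> ((nat \<Rightarrow> real) \<Rightarrow> 'a) \<Rightarrow> bool" where
  "characteristic_map T d e \<Phi> \<longleftrightarrow>
     continuous_map (closed_disk d) T \<Phi> \<and>
     homeomorphic_map (subtopology (closed_disk d) (disk_interior d)) (subtopology T e) \<Phi>"

text \<open>
  The space \<open>T\<close> is a finite CW complex whose open cells are the sets
  \<open>\<sigma>\<^sub>i = X i - X (i - 1)\<close> for \<open>1 \<le> i \<le> n\<close>. The cells may be added in any order for which the
  boundary of each cell lies in the earlier cells of smaller dimension, so that every \<open>X i\<close>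
  is a subcomplex. The first cell is a vertex.
\<close>

definition filtered_cell_complex :: "'a topology \<Rightarrow> nat \<Rightarrow> (nat \<Rightarrow> 'a set) \<Rightarrow> bool" where
  "filtered_cell_complex T n X \<longleftrightarrow>
     Hausdorff_space T \<and> 1 \<le> n \<and> X 0 = {} \<and> X n = topspace T \<and>
     (\<exists>dm \<Phi>. dm 1 = 0 \<and>
       (\<forall>i\<in>{1..n}.
          X (i - 1) \<subseteq> X i \<and>
          characteristic_map T (dm i) (X i - X (i - 1)) (\<Phi> i) \<and>
          \<Phi> i ` disk_boundary (dm i) \<subseteq> (\<Union>j\<in>{j\<in>{1..<i}. dm j < dm i}. X j - X (j - 1))))"


section \<open>Singular homology with coefficients in a field\<close>

text \<open>
  The library develops singular homology with integer coefficients only. The definitions below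
  follow those of \<^theory>\<open>HOL-Homology.Simplices\<close> with coefficients in \<open>'k\<close>. As singular simplices
  are extensional functions on the standard simplex, a chain of a subspace is literally a chain of
  the whole space. Degrees are integers, and there are no nonzero chains of negative degree.
\<close>

type_synonym ('a, 'k) kchain = "((nat \<Rightarrow> real) \<Rightarrow> 'a) \<Rightarrow>\<^sub>0 'k"

definition kchain_scale :: "'k::field \<Rightarrow> ('a, 'k) kchain \<Rightarrow> ('a, 'k) kchain" where
  "kchain_scale r c = Poly_Mapping.map ((*) r) c"

definition kchains :: "int \<Rightarrow> 'a topology \<Rightarrow> ('a, 'k::field) kchain set" where
  "kchains p X =
     {c. Poly_Mapping.keys c \<subseteq> (if p < 0 then {} else singular_simplex_set (nat p) X)}"

definition kboundary :: "int \<Rightarrow> ('a, 'k::field) kchain \<Rightarrow> ('a, 'k) kchain" where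
  "kboundary p c =
     (if p \<le> 0 then 0
      else \<Sum>f\<in>Poly_Mapping.keys c. \<Sum>j\<le>nat p.
             Poly_Mapping.single (singular_face (nat p) j f) ((-1) ^ j * Poly_Mapping.lookup c f))"

definition krelcycles :: "int \<Rightarrow> 'a topology \<Rightarrow> 'a set \<Rightarrow> ('a, 'k::field) kchain set" where
  "krelcycles p X S = {c \<in> kchains p X. kboundary p c \<in> kchains (p - 1) (subtopology X S)}"

definition krelboundaries :: "int \<Rightarrow> 'a topology \<Rightarrow> 'a set \<Rightarrow> ('a, 'k::field) kchain set" where
  "krelboundaries p X S =
     {c. \<exists>d\<in>kchains (p + 1) X. kboundary (p + 1) d - c \<in> kchains p (subtopology X S)}"

text \<open>
  The quotient of the relative cycles by the relative boundaries; its elements are cosets. The ring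
  multiplication that the record type \<open>module\<close> inherits from rings plays no role.
\<close>

definition khomology ::
  "int \<Rightarrow> 'a topology \<Rightarrow> 'a set \<Rightarrow> ('k::field, ('a, 'k) kchain set) module" where
  "khomology p X S =
     \<lparr>carrier = (\<lambda>z. {z + b |b. b \<in> krelboundaries p X S}) ` krelcycles p X S,
      mult = (\<lambda>_ _. undefined), one = undefined,
      zero = krelboundaries p X S,
      add = (\<lambda>A A'. {a + a' |a a'. a \<in> A \<and> a' \<in> A'}),
      smult = (\<lambda>r A. {kchain_scale r a + b |a b. a \<in> A \<and> b \<in> krelboundaries p X S})\<rparr>"

text \<open>
  The map into the homology of \<open>(Y, S')\<close> induced by an inclusion of pairs
  \<open>(X, S) \<subseteq> (Y, S')\<close>: it sends the class of a cycle \<open>z\<close> to the class of \<open>z\<close>.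
\<close>

definition khom_inclusion ::
  "int \<Rightarrow> 'a topology \<Rightarrow> 'a set \<Rightarrow> ('a, 'k::field) kchain set \<Rightarrow> ('a, 'k) kchain set" where
  "khom_inclusion p Y S' A = {a + b |a b. a \<in> A \<and> b \<in> krelboundaries p Y S'}"


section \<open>Persistence modules and their diagrams\<close>

text \<open>
  A sequence of vector spaces indexed by \<open>pm_first, \<dots>, pm_last\<close>; \<open>pm_map M i\<close> goes from
  \<open>pm_space M i\<close> to \<open>pm_space M (i + 1)\<close>.
\<close>

record ('k, 'v) persistence_module =
  pm_first :: nat
  pm_last :: nat
  pm_space :: "nat \<Rightarrow> ('k, 'v) module"
  pm_map :: "nat \<Rightarrow> 'v \<Rightarrow> 'v"

definition linear_iso :: "('k, 'v) module \<Rightarrow> ('k, 'w) module \<Rightarrow> ('v \<Rightarrow> 'w) \<Rightarrow> bool" where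
  "linear_iso V W h \<longleftrightarrow>
     bij_betw h (carrier V) (carrier W) \<and>
     (\<forall>x\<in>carrier V. \<forall>y\<in>carrier V. h (x \<oplus>\<^bsub>V\<^esub> y) = h x \<oplus>\<^bsub>W\<^esub> h y) \<and>
     (\<forall>r. \<forall>x\<in>carrier V. h (r \<odot>\<^bsub>V\<^esub> x) = r \<odot>\<^bsub>W\<^esub> h x)"

definition pm_isomorphic ::
  "('k, 'v) persistence_module \<Rightarrow> ('k, 'w) persistence_module \<Rightarrow> bool" where
  "pm_isomorphic M N \<longleftrightarrow>
     pm_first M = pm_first N \<and> pm_last M = pm_last N \<and>
     (\<exists>h. (\<forall>i\<in>{pm_first M..pm_last M}. linear_iso (pm_space M i) (pm_space N i) (h i)) \<and>
          (\<forall>i\<in>{pm_first M..<pm_last M}. \<forall>x\<in>carrier (pm_space M i).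
             h (i + 1) (pm_map M i x) = pm_map N i (h i x)))"

definition interval_module ::
  "nat \<Rightarrow> nat \<Rightarrow> nat \<times> nat \<Rightarrow> ('k::field, 'k) persistence_module" where
  "interval_module lo hi pq =
     \<lparr>pm_first = lo, pm_last = hi,
      pm_space = (\<lambda>i.
        \<lparr>carrier = (if fst pq \<le> i \<and> i \<le> snd pq then UNIV else {0}),
         mult = (*), one = 1, zero = 0, add = (+), smult = (*)\<rparr>),
      pm_map = (\<lambda>i x. if fst pq \<le> i \<and> i + 1 \<le> snd pq then x else 0)\<rparr>"

definition pm_direct_sum ::
  "nat \<Rightarrow> nat \<Rightarrow> 'j set \<Rightarrow> ('j \<Rightarrow> ('k, 'v) persistence_module)
     \<Rightarrow> ('k, 'j \<Rightarrow> 'v) persistence_module" where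
  "pm_direct_sum lo hi J N =
     \<lparr>pm_first = lo, pm_last = hi,
      pm_space = (\<lambda>i.
        \<lparr>carrier = {c \<in> \<Pi>\<^sub>E j\<in>J. carrier (pm_space (N j) i).
                       finite {j\<in>J. c j \<noteq> \<zero>\<^bsub>pm_space (N j) i\<^esub>}},
         mult = (\<lambda>_ _. undefined), one = undefined,
         zero = (\<lambda>j\<in>J. \<zero>\<^bsub>pm_space (N j) i\<^esub>),
         add = (\<lambda>c c'. \<lambda>j\<in>J. c j \<oplus>\<^bsub>pm_space (N j) i\<^esub> c' j),
         smult = (\<lambda>r c. \<lambda>j\<in>J. r \<odot>\<^bsub>pm_space (N j) i\<^esub> c j)\<rparr>),
      pm_map = (\<lambda>i c. \<lambda>j\<in>J. pm_map (N j) i (c j))\<rparr>"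

text \<open>
  The summands are indexed by a set \<open>J\<close> of intervals \<open>(p, q)\<close> carrying a label that tells repeated
  intervals apart. One generator per summand suffices as a label, so labels in \<open>'v\<close> are no
  restriction.
\<close>

definition interval_decomposition ::
  "('k::field, 'v) persistence_module \<Rightarrow> ((nat \<times> nat) \<times> 'v) set \<Rightarrow> bool" where
  "interval_decomposition M J \<longleftrightarrow>
     (\<forall>((p, q), v)\<in>J. pm_first M \<le> p \<and> p \<le> q \<and> q \<le> pm_last M) \<and>
     pm_isomorphic M
       (pm_direct_sum (pm_first M) (pm_last M) J
          (\<lambda>j. interval_module (pm_first M) (pm_last M) (fst j)))"

text \<open>
  A multiset is given by its multiplicities. They take values in \<^typ>\<open>enat\<close> because the spaces of
  a \<open>persistence_module\<close> are not required to be finite-dimensional; for finite-dimensional ones all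
  multiplicities are finite.
\<close>

type_synonym 'i emultiset = "'i \<Rightarrow> enat"

definition ecard :: "'i set \<Rightarrow> enat" where
  "ecard A = (if finite A then enat (card A) else \<infinity>)"

definition Pers :: "('k::field, 'v) persistence_module \<Rightarrow> (nat \<times> nat) emultiset" where
  "Pers M = (THE D. \<exists>J. interval_decomposition M J \<and> D = (\<lambda>pq. ecard {v. (pq, v) \<in> J}))"

text \<open>The argument \<open>'k itself\<close> names the coefficient field.\<close>

definition abs_persistence ::
  "'k::field itself \<Rightarrow> 'a topology \<Rightarrow> nat \<Rightarrow> (nat \<Rightarrow> 'a set) \<Rightarrow> int
     \<Rightarrow> ('k, ('a, 'k) kchain set) persistence_module" where
  "abs_persistence _ T n X k =
     \<lparr>pm_first = 1, pm_last = n,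
      pm_space = (\<lambda>i. khomology k (subtopology T (X i)) {}),
      pm_map = (\<lambda>i. khom_inclusion k (subtopology T (X (i + 1))) {})\<rparr>"

text \<open>At index \<open>0\<close> this is the absolute homology of \<open>X n\<close>, as \<open>X 0 = {}\<close>.\<close>

definition rel_persistence ::
  "'k::field itself \<Rightarrow> 'a topology \<Rightarrow> nat \<Rightarrow> (nat \<Rightarrow> 'a set) \<Rightarrow> int
     \<Rightarrow> ('k, ('a, 'k) kchain set) persistence_module" where
  "rel_persistence _ T n X k =
     \<lparr>pm_first = 0, pm_last = n - 1,
      pm_space = (\<lambda>i. khomology k (subtopology T (X n)) (X i)),
      pm_map = (\<lambda>i. khom_inclusion k (subtopology T (X n)) (X (i + 1)))\<rparr>"


section \<open>Finite and infinite intervals\<close>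

definition index_value :: "nat \<Rightarrow> (nat \<Rightarrow> real) \<Rightarrow> nat \<Rightarrow> ereal" where
  "index_value n a i = (if i = 0 then -\<infinity> else if i \<le> n then ereal (a i) else \<infinity>)"

text \<open>The half-open interval \<open>[a\<^sub>p, a\<^sub>q\<^sub>+\<^sub>1)\<close>, represented by its pair of endpoints.\<close>

definition interval_of :: "nat \<Rightarrow> (nat \<Rightarrow> real) \<Rightarrow> nat \<times> nat \<Rightarrow> ereal \<times> ereal" where
  "interval_of n a pq = (index_value n a (fst pq), index_value n a (snd pq + 1))"

definition finite_interval :: "ereal \<times> ereal \<Rightarrow> bool" where
  "finite_interval I \<longleftrightarrow> \<bar>fst I\<bar> \<noteq> \<infinity> \<and> \<bar>snd I\<bar> \<noteq> \<infinity>"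

definition Pers_0 ::
  "nat \<Rightarrow> (nat \<Rightarrow> real) \<Rightarrow> ('k::field, 'v) persistence_module \<Rightarrow> (nat \<times> nat) emultiset" where
  "Pers_0 n a M pq = (if finite_interval (interval_of n a pq) then Pers M pq else 0)"

definition Pers_inf ::
  "nat \<Rightarrow> (nat \<Rightarrow> real) \<Rightarrow> ('k::field, 'v) persistence_module \<Rightarrow> (nat \<times> nat) emultiset" where
  "Pers_inf n a M pq = (if finite_interval (interval_of n a pq) then 0 else Pers M pq)"

text \<open>The multiset of intervals obtained from a multiset of index pairs \<open>0 \<le> p \<le> q \<le> n\<close>.\<close>

definition intervals ::
  "nat \<Rightarrow> (nat \<Rightarrow> real) \<Rightarrow> (nat \<times> nat) emultiset \<Rightarrow> (ereal \<times> ereal) emultiset" where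
  "intervals n a D I =
     (\<Sum>pq\<in>{pq. fst pq \<le> snd pq \<and> snd pq \<le> n \<and> interval_of n a pq = I}. D pq)"

definition emultiset_bij :: "('i \<Rightarrow> 'j) \<Rightarrow> 'i emultiset \<Rightarrow> 'j emultiset \<Rightarrow> bool" where
  "emultiset_bij f D E \<longleftrightarrow>
     bij_betw f {x. D x \<noteq> 0} {y. E y \<noteq> 0} \<and> (\<forall>x. D x \<noteq> 0 \<longrightarrow> E (f x) = D x)"

end

(* Over a field, each of the persistence modules is a sequence of quotients F_i / G_i of two flags in
   one vector space: Z_k(X_i) / B_k(X_i) in the absolute case, and the preimage of C_{k-1}(X_i) under
   the boundary operator modulo B_k(X) + C_k(X_i) in the relative case. Two flags always have a common
   adapted basis, which decomposes such a module into intervals. The multiplicity of [p, q] is the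
   dimension of F_p \<inter> G_{q+1} modulo F_{p-1} \<inter> G_{q+1} + F_p \<inter> G_q. The boundary operator
   matches these pieces in the relative module of degree k + 1 and the absolute one of degree k for
   finite intervals, and the inclusion of Z_k(X_p) matches them in degree k for infinite ones. *)

theory Submission
  imports Defs
begin

section \<open>Linear algebra of two flags\<close>

text \<open>\<open>Pers\<close> is a definite description, so exhibiting one decomposition is not
  enough: all decompositions must have the same multiplicities. The codimension formula settles this
  because it mentions only the flags; evaluating it in an arbitrary decomposition yields uniqueness
  and the value of \<open>Pers\<close> at once. The obstacle is size: spaces of singular chains are
  infinite-dimensional in general, so ranks of maps between them cannot be counted and subtracted.
  Dimensions of quotients are therefore taken in \<open>enat\<close> through chosen complements, and
  two of them are shown equal by a linear map of the ambient spaces that induces an isomorphism of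
  the quotients.\<close>

locale field_space = vector_space scale
  for scale :: "'a::field \<Rightarrow> 'b::ab_group_add \<Rightarrow> 'b"
begin

text \<open>For subspaces \<open>U \<subseteq> A\<close>, the classes of \<open>S\<close> form a
  basis of \<open>A / U\<close>. Stating this through representatives avoids forming the
  quotient.\<close>

definition cobasis :: "'b set \<Rightarrow> 'b set \<Rightarrow> 'b set \<Rightarrow> bool" where
  "cobasis U A S \<longleftrightarrow> S \<subseteq> A \<and> A \<subseteq> span (U \<union> S) \<and> independent S \<and> span S \<inter> U \<subseteq> {0}"

text \<open>The dimension of \<open>A / U\<close>, with all infinite cardinals identified. It does
  not depend on the chosen \<open>S\<close>, by \<open>codim_eq\<close>.\<close>

definition codim :: "'b set \<Rightarrow> 'b set \<Rightarrow> enat" where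
  "codim U A = ecard (SOME S. cobasis U A S)"

definition sum_space :: "'b set \<Rightarrow> 'b set \<Rightarrow> 'b set" where
  "sum_space U W = {u + w |u w. u \<in> U \<and> w \<in> W}"

lemma subspace_sum_space: "subspace U \<Longrightarrow> subspace W \<Longrightarrow> subspace (sum_space U W)"
  unfolding sum_space_def by (rule subspace_sums)

lemma sum_spaceI: "u \<in> U \<Longrightarrow> w \<in> W \<Longrightarrow> u + w \<in> sum_space U W"
  unfolding sum_space_def by blast

lemma sum_space_upper1: "subspace W \<Longrightarrow> U \<subseteq> sum_space U W"
  using sum_spaceI[of _ U 0 W] subspace_0 by auto

lemma sum_space_upper2: "subspace U \<Longrightarrow> W \<subseteq> sum_space U W"
  using sum_spaceI[of 0 U _ W] subspace_0 by auto

lemma sum_space_least: "subspace A \<Longrightarrow> U \<subseteq> A \<Longrightarrow> W \<subseteq> A \<Longrightarrow> sum_space U W \<subseteq> A"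
  unfolding sum_space_def using subspace_add by blast

text \<open>A vanishing combination splits into a \<open>B\<close> part and an \<open>S\<close> part
  that are negatives of each other. Both lie in the intersection of the spans, so each vanishes
  separately.\<close>

lemma independent_Un_disjoint_span:
  assumes B: "independent B" and S: "independent S" and d: "span B \<inter> span S \<subseteq> {0}"
  shows "independent (B \<union> S)"
proof
  assume "dependent (B \<union> S)"
  then obtain t u v where t: "finite t" "t \<subseteq> B \<union> S" "(\<Sum>v\<in>t. scale (u v) v) = 0" "v \<in> t" "u v \<noteq> 0"
    unfolding dependent_explicit by force
  have B0: "0 \<notin> B" using B dependent_zero by blast
  have dis: "B \<inter> S = {}"
    using d span_base B0 by blast
  let ?b = "\<Sum>v\<in>t \<inter> B. scale (u v) v" and ?s = "\<Sum>v\<in>t \<inter> S. scale (u v) v"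
  have "t = (t \<inter> B) \<union> (t \<inter> S)" using t(2) by blast
  then have "(\<Sum>v\<in>t. scale (u v) v) = ?b + ?s"
    using sum.union_disjoint[of "t \<inter> B" "t \<inter> S" "\<lambda>v. scale (u v) v"] t(1) dis by fastforce
  then have e: "?b = - ?s" using t(3) by (simp add: eq_neg_iff_add_eq_0)
  have b: "?b \<in> span B" and s: "?s \<in> span S"
    by (rule span_sum, rule span_scale, rule span_base, simp)+
  have "?b \<in> span S" using e s span_neg by simp
  then have "?b = 0" using b d by blast
  moreover from this have "?s = 0" using e by simp
  ultimately show False
    using independentD[OF B, of "t \<inter> B" u v] independentD[OF S, of "t \<inter> S" u v] t by auto
qed

text \<open>Extend a basis \<open>B\<close> of \<open>U\<close> to a basis \<open>C\<close> of
  \<open>A\<close> and discard \<open>B\<close>.\<close>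

lemma cobasis_exists:
  assumes U: "subspace U" and A: "subspace A" and UA: "U \<subseteq> A"
  shows "\<exists>S. cobasis U A S"
proof -
  obtain B where B: "B \<subseteq> U" "independent B" "U \<subseteq> span B"
    using basis_exists[of U] by metis
  obtain C where C: "B \<subseteq> C" "C \<subseteq> A" "independent C" "A \<subseteq> span C"
    using maximal_independent_subset_extend[of B A] B UA by blast
  have sB: "span B = U" using B U span_subspace by blast
  let ?S = "C - B"
  have "span (U \<union> ?S) \<supseteq> span C"
    by (rule span_mono) (use B in auto)
  moreover have "span ?S \<inter> U \<subseteq> {0}"
  proof
    fix x assume x: "x \<in> span ?S \<inter> U"
    then have "x \<in> span B" using sB by simp
    \<comment> \<open>As \<open>x\<close> lies in \<open>span B\<close>, it has no coordinates off
      \<open>B\<close>; as it lies in \<open>span (C - B)\<close>, it has none on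
      \<open>B\<close>.\<close>
    have "representation C x v = 0" for v
    proof (cases "v \<in> B")
      case True
      have "representation C x = representation ?S x"
        using representation_extend[OF C(3), of x ?S] x by auto
      then show ?thesis using True representation_ne_zero[of ?S x v] by auto
    next
      case False
      have "representation C x = representation B x"
        using representation_extend[OF C(3), of x B] C(1) \<open>x \<in> span B\<close> by auto
      then show ?thesis using False representation_ne_zero[of B x v] by auto
    qed
    moreover have "x \<in> span C" using \<open>x \<in> span B\<close> C(1) span_mono by blast
    ultimately show "x \<in> {0}"
      using sum_nonzero_representation_eq[OF C(3), of x] by simp
  qed
  moreover have "?S \<subseteq> A" "independent ?S" using C independent_mono[of C ?S] by auto
  moreover have "A \<subseteq> span C" by (fact C)
  ultimately have "cobasis U A ?S" by (simp add: cobasis_def)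
  then show ?thesis ..
qed

lemma cobasis_card_le:
  assumes U: "subspace U" and S: "cobasis U A S" and S': "cobasis U A S'" and fin: "finite S"
  shows "finite S' \<and> card S' \<le> card S"
proof -
  interpret endo: vector_space_pair scale scale by unfold_locales
  obtain B where B: "B \<subseteq> U" "independent B" "U \<subseteq> span B"
    using basis_exists[of U] by metis
  have sB: "span B = U" using B U span_subspace by blast
  have ind: "independent (B \<union> S')"
    using S' B sB by (intro independent_Un_disjoint_span) (auto simp: cobasis_def)
  obtain g where g: "Vector_Spaces.linear scale scale g"
      "\<And>x. x \<in> B \<union> S' \<Longrightarrow> g x = (if x \<in> B then 0 else x)"
    using endo.linear_independent_extend[OF ind, of "\<lambda>x. if x \<in> B then 0 else x"] by blast
  interpret g: Vector_Spaces.linear scale scale g by fact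
  have g0: "g x = 0" if "x \<in> U" for x
    using g.eq_0_on_span[of B x] that sB g(2) by auto
  have "0 \<notin> S'" using S' dependent_zero unfolding cobasis_def by blast
  then have "S' \<inter> B = {}"
    using S' B(1) span_superset[of S'] unfolding cobasis_def by auto
  then have gS: "g ` S' = S'" using g(2) by (auto simp: image_iff disjoint_iff)
  have "S' \<subseteq> A" "A \<subseteq> span (U \<union> S)" using S S' by (simp_all add: cobasis_def)
  then have "S' \<subseteq> span (U \<union> S)" by (rule order_trans)
  then have "g ` S' \<subseteq> span (g ` (U \<union> S))" by (rule g.spans_image)
  also have "\<dots> \<subseteq> span (g ` S)"
  proof (rule span_minimal)
    show "g ` (U \<union> S) \<subseteq> span (g ` S)"
      using g0 span_base span_zero by auto
  qed simp
  finally have "S' \<subseteq> span (g ` S)" using gS by simp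
  then have "finite S' \<and> card S' \<le> card (g ` S)"
    using S' fin independent_span_bound[of "g ` S" S'] by (simp add: cobasis_def)
  then show ?thesis using card_image_le[OF fin, of g] by linarith
qed

lemma codim_eq:
  assumes U: "subspace U" and S: "cobasis U A S"
  shows "codim U A = ecard S"
proof -
  define S' where "S' = (SOME S. cobasis U A S)"
  have S': "cobasis U A S'" unfolding S'_def using S by (rule someI)
  have "ecard S' = ecard S"
    using cobasis_card_le[OF U S S'] cobasis_card_le[OF U S' S] unfolding ecard_def by auto
  then show ?thesis unfolding codim_def S'_def .
qed

text \<open>The hypotheses say that \<open>f\<close> induces an isomorphism \<open>A / U \<cong> A' / U'\<close>.\<close>

lemma cobasis_image:
  assumes f: "Vector_Spaces.linear scale scale f" and S: "cobasis U A S"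
    and A: "subspace A" and U': "subspace U'"
    and maps: "\<And>x. x \<in> A \<Longrightarrow> f x \<in> A'"
    and ker: "\<And>x. x \<in> A \<Longrightarrow> f x \<in> U' \<longleftrightarrow> x \<in> U"
    and surj: "\<And>y. y \<in> A' \<Longrightarrow> \<exists>x\<in>A. y - f x \<in> U'"
    and UA: "U \<subseteq> A"
  shows "cobasis U' A' (f ` S)" "inj_on f S"
proof -
  interpret f: Vector_Spaces.linear scale scale f by fact
  note S = S[unfolded cobasis_def]
  have spS: "span S \<subseteq> A" using S A span_minimal by blast
  have inj: "inj_on f (span S)"
  proof (rule inj_onI)
    fix x y assume xy: "x \<in> span S" "y \<in> span S" "f x = f y"
    then have "f (x - y) = 0" by (simp add: f.diff)
    then have "x - y \<in> U"
      using ker[of "x - y"] xy spS span_diff subspace_0[OF U'] by auto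
    then show "x = y" using S span_diff xy by force
  qed
  then show "inj_on f S" by (rule inj_on_subset) (rule span_superset)
  have "y \<in> span (U' \<union> f ` S)" if y: "y \<in> A'" for y
  proof -
    obtain x where x: "x \<in> A" "y - f x \<in> U'" using surj[OF y] by blast
    have "f x \<in> span (f ` (U \<union> S))" using S x f.span_image by blast
    also have "\<dots> \<subseteq> span (U' \<union> f ` S)"
      by (rule span_mono) (use ker UA in blast)
    finally show ?thesis
      using span_add[of "y - f x" _ "f x"] x(2) span_base[of "y - f x" "U' \<union> f ` S"] by auto
  qed
  moreover have "span (f ` S) \<inter> U' \<subseteq> {0}"
  proof
    fix y assume y: "y \<in> span (f ` S) \<inter> U'"
    then obtain x where x: "x \<in> span S" "y = f x" using f.span_image by auto
    then have "x \<in> U" using y ker spS by blast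
    then show "y \<in> {0}" using x S by auto
  qed
  moreover have "independent (f ` S)"
    using f.independent_injective_image[OF _ inj] S by simp
  moreover have "f ` S \<subseteq> A'" using S maps by blast
  ultimately show "cobasis U' A' (f ` S)"
    by (simp add: cobasis_def subset_iff)
qed

text \<open>The device by which multiplicities in the absolute and the relative modules are
  compared. Only the behaviour of \<open>f\<close> on \<open>A\<close> enters the
  conditions.\<close>

lemma codim_transport:
  assumes f: "Vector_Spaces.linear scale scale f"
    and sub: "subspace A" "subspace U" "subspace U'" "U \<subseteq> A"
    and "\<And>x. x \<in> A \<Longrightarrow> f x \<in> A'" "\<And>x. x \<in> A \<Longrightarrow> f x \<in> U' \<longleftrightarrow> x \<in> U"
    and "\<And>y. y \<in> A' \<Longrightarrow> \<exists>x\<in>A. y - f x \<in> U'"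
  shows "codim U A = codim U' A'"
proof -
  obtain S where S: "cobasis U A S" using cobasis_exists sub by blast
  note im = cobasis_image[OF f S sub(1,3) assms(6-8) sub(4)]
  have "ecard (f ` S) = ecard S"
    using im(2) unfolding ecard_def by (auto simp: card_image finite_image_iff)
  then show ?thesis using codim_eq[OF sub(2) S] codim_eq[OF sub(3) im(1)] by simp
qed

text \<open>Since \<open>span S\<close> lies in \<open>W\<close> and \<open>span S'\<close> meets
  \<open>W\<close> only in 0, an element of \<open>U\<close> in the joint span first loses its
  \<open>S'\<close> component and then its \<open>S\<close> component.\<close>

lemma cobasis_trans:
  assumes S: "cobasis U W S" and S': "cobasis W A S'"
    and sub: "subspace U" "subspace W" "U \<subseteq> W" "W \<subseteq> A"
  shows "cobasis U A (S \<union> S')"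
proof -
  note S = S[unfolded cobasis_def] and S' = S'[unfolded cobasis_def]
  have spS: "span S \<subseteq> W" using S sub span_minimal by blast
  have ind: "independent (S \<union> S')"
    by (rule independent_Un_disjoint_span) (use S S' spS in auto)
  have "W \<union> S' \<subseteq> span (U \<union> (S \<union> S'))"
  proof (rule Un_least)
    show "W \<subseteq> span (U \<union> (S \<union> S'))"
    proof (rule order_trans[of _ "span (U \<union> S)"])
      show "span (U \<union> S) \<subseteq> span (U \<union> (S \<union> S'))" by (rule span_mono) auto
    qed (use S in simp)
    show "S' \<subseteq> span (U \<union> (S \<union> S'))"
      by (rule order_trans[OF _ span_superset]) auto
  qed
  then have "span (W \<union> S') \<subseteq> span (U \<union> (S \<union> S'))"
    by (rule span_minimal) simp
  moreover have "span (S \<union> S') \<inter> U \<subseteq> {0}"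
  proof
    fix x assume x: "x \<in> span (S \<union> S') \<inter> U"
    then obtain s s' where s: "x = s + s'" "s \<in> span S" "s' \<in> span S'" unfolding span_Un by blast
    have "s' = x - s" using s by simp
    then have "s' \<in> W" using x s spS sub subspace_diff by blast
    then have "s' = 0" using s S' by blast
    then show "x \<in> {0}" using s x S by auto
  qed
  moreover have "S \<union> S' \<subseteq> A" using S S' sub by auto
  moreover have "A \<subseteq> span (W \<union> S')" using S' by simp
  ultimately show ?thesis using ind unfolding cobasis_def by (simp add: subset_trans[of A])
qed

lemma cobasis_chain:
  assumes sub: "\<And>i. subspace (W i)" and mono: "\<And>i. W i \<subseteq> W (Suc i)"
    and S: "\<And>i. i < n \<Longrightarrow> cobasis (W i) (W (Suc i)) (S i)"
  shows "cobasis (W 0) (W n) (\<Union>i<n. S i)"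
  using S
proof (induction n)
  case 0
  then show ?case unfolding cobasis_def by (simp add: span_superset independent_empty)
next
  case (Suc n)
  have m: "W 0 \<subseteq> W n" using lift_Suc_mono_le[of W 0 n] mono by blast
  have "cobasis (W 0) (W (Suc n)) ((\<Union>i<n. S i) \<union> S n)"
    by (rule cobasis_trans[of _ "W n"]) (use Suc sub mono m in auto)
  then show ?case by (simp add: lessThan_Suc Un_commute)
qed

text \<open>The basis is the union of the \<open>S p q\<close>, which complement the earlier pieces of the bigraded
  filtration \<open>f p \<inter> g q\<close>: refining \<open>f p \<subseteq> f (p + 1)\<close> by \<open>g\<close> adds them one at a time.\<close>

lemma adapted_basis:
  fixes f g :: "nat \<Rightarrow> 'b set"
  assumes sf: "\<And>i. subspace (f i)" and sg: "\<And>i. subspace (g i)"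
    and mf: "mono f" and mg: "mono g" and f0: "f 0 = {0}" and g0: "g 0 = {0}"
  shows "\<exists>E. independent E \<and> E \<subseteq> f M \<inter> g N \<and>
           (\<forall>p\<le>M. \<forall>q\<le>N. f p \<inter> g q \<subseteq> span (E \<inter> (f p \<inter> g q)))"
proof -
  \<comment> \<open>The part of the piece at \<open>(p, q)\<close> that is already present at an
    earlier stage of one of the two flags.\<close>
  define U where "U p q = sum_space (f p \<inter> g (Suc q)) (f (Suc p) \<inter> g q)" for p q
  have mf': "f p \<subseteq> f q" and mg': "g p \<subseteq> g q" if "p \<le> q" for p q
    using mf mg that by (auto dest: monoD)
  have sU: "subspace (U p q)" for p q
    unfolding U_def by (intro subspace_sum_space subspace_inter sf sg)
  have UA: "U p q \<subseteq> f (Suc p) \<inter> g (Suc q)" for p q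
    unfolding U_def using mf'[of p "Suc p"] mg'[of q "Suc q"]
    by (intro sum_space_least subspace_inter sf sg) auto
  have "\<forall>p q. \<exists>S. cobasis (U p q) (f (Suc p) \<inter> g (Suc q)) S"
    using cobasis_exists[OF sU _ UA] subspace_inter sf sg by blast
  then obtain S where S: "\<And>p q. cobasis (U p q) (f (Suc p) \<inter> g (Suc q)) (S p q)" by metis
  have row: "cobasis (f p \<inter> g Q) (f (Suc p) \<inter> g Q) (\<Union>q<Q. S p q)" for p Q
  proof -
    \<comment> \<open>A chain from \<open>f p \<inter> g Q\<close> to
      \<open>f (Suc p) \<inter> g Q\<close>; the truncation by \<open>min\<close> keeps every
      \<open>W q\<close> inside the latter.\<close>
    define W where "W q = sum_space (f p \<inter> g Q) (f (Suc p) \<inter> g (min q Q))" for q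
    have sW: "subspace (W q)" for q
      unfolding W_def by (intro subspace_sum_space subspace_inter sf sg)
    have mW: "W q \<subseteq> W (Suc q)" for q
      unfolding W_def sum_space_def using mg'[of "min q Q" "min (Suc q) Q"] by fastforce
    have step: "cobasis (W q) (W (Suc q)) (S p q)" if q: "q < Q" for q
    proof -
      have W: "W q = sum_space (f p \<inter> g Q) (f (Suc p) \<inter> g q)"
        "W (Suc q) = sum_space (f p \<inter> g Q) (f (Suc p) \<inter> g (Suc q))"
        using q by (simp_all add: W_def min_def)
      \<comment> \<open>This is the Zassenhaus isomorphism: inclusion identifies the piece modulo
        \<open>U p q\<close> with \<open>W (Suc q)\<close> modulo \<open>W q\<close>, so the
        complement \<open>S p q\<close>, chosen independently of \<open>Q\<close>, serves in every
        row.\<close>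
      have "cobasis (W q) (W (Suc q)) ((\<lambda>x. x) ` S p q)"
      proof (rule cobasis_image(1)[OF linear_ident S])
        show "x \<in> W (Suc q)" if "x \<in> f (Suc p) \<inter> g (Suc q)" for x
          unfolding W using that sum_space_upper2[of "f p \<inter> g Q"] subspace_inter sf sg by blast
        show "x \<in> W q \<longleftrightarrow> x \<in> U p q" if x: "x \<in> f (Suc p) \<inter> g (Suc q)" for x
        proof
          assume "x \<in> W q"
          then obtain y z where yz: "x = y + z" "y \<in> f p" "z \<in> f (Suc p)" "z \<in> g q"
            unfolding W sum_space_def by blast
          have "y = x - z" using yz by simp
          moreover have "z \<in> g (Suc q)" using yz mg'[of q "Suc q"] by auto
          ultimately have "y \<in> g (Suc q)" using x sg subspace_diff by blast
          then show "x \<in> U p q" unfolding U_def using yz sum_spaceI by blast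
        next
          assume "x \<in> U p q"
          then show "x \<in> W q"
            unfolding U_def W sum_space_def using mg'[of "Suc q" Q] q by fastforce
        qed
        show "\<exists>x\<in>f (Suc p) \<inter> g (Suc q). y - x \<in> W q" if y: "y \<in> W (Suc q)" for y
        proof -
          obtain u z where uz: "y = u + z" "u \<in> f p \<inter> g Q" "z \<in> f (Suc p) \<inter> g (Suc q)"
            using y unfolding W sum_space_def by blast
          have "u \<in> W q"
            unfolding W using uz sum_space_upper1[of "f (Suc p) \<inter> g q"] subspace_inter sf sg by blast
          then show ?thesis using uz by (intro bexI[of _ z]) auto
        qed
      qed (use UA sW in \<open>auto intro: subspace_inter sf sg\<close>)
      then show ?thesis by simp
    qed
    have "cobasis (W 0) (W Q) (\<Union>q<Q. S p q)"
      by (rule cobasis_chain) (use sW mW step in auto)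
    moreover have "W 0 = f p \<inter> g Q"
    proof -
      have "f (Suc p) \<inter> g (min 0 Q) = {0}" using g0 subspace_0[OF sf] by auto
      then show ?thesis unfolding W_def sum_space_def by auto
    qed
    moreover have "W Q = f (Suc p) \<inter> g Q"
    proof
      show "W Q \<subseteq> f (Suc p) \<inter> g Q"
        unfolding W_def using mf'[of p "Suc p"]
        by (intro sum_space_least subspace_inter sf sg) auto
      show "f (Suc p) \<inter> g Q \<subseteq> W Q"
        unfolding W_def using sum_space_upper2[of "f p \<inter> g Q"] subspace_inter sf sg by simp
    qed
    ultimately show ?thesis by simp
  qed
  \<comment> \<open>Stacking the rows gives a basis of each intersection out of the same sets
    \<open>S p q\<close>, which is what makes the one set \<open>E\<close> adapted to both
    flags.\<close>
  have all: "cobasis {0} (f P \<inter> g Q) (\<Union>p<P. \<Union>q<Q. S p q)" for P Q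
  proof -
    have "cobasis (f 0 \<inter> g Q) (f P \<inter> g Q) (\<Union>p<P. \<Union>q<Q. S p q)"
      by (rule cobasis_chain[of "\<lambda>p. f p \<inter> g Q"])
        (use row mf'[OF le_SucI[OF order_refl]] in \<open>auto intro: subspace_inter sf sg\<close>)
    moreover have "f 0 \<inter> g Q = {0}" using f0 subspace_0[OF sg] by auto
    ultimately show ?thesis by simp
  qed
  define E where "E = (\<Union>p<M. \<Union>q<N. S p q)"
  have "f p \<inter> g q \<subseteq> span (E \<inter> (f p \<inter> g q))" if "p \<le> M" "q \<le> N" for p q
  proof -
    let ?T = "\<Union>p'<p. \<Union>q'<q. S p' q'"
    have T: "?T \<subseteq> f p \<inter> g q" "f p \<inter> g q \<subseteq> span (insert 0 ?T)"
      using all[of p q] unfolding cobasis_def by auto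
    have "?T \<subseteq> E" unfolding E_def using that by fastforce
    then have "span ?T \<subseteq> span (E \<inter> (f p \<inter> g q))" using T by (intro span_mono) blast
    then show ?thesis using T(2) by simp
  qed
  then show ?thesis using all[of M N] unfolding E_def cobasis_def by blast
qed

end

section \<open>Quotients of two flags as persistence modules\<close>

abbreviation interval_sum ::
  "nat \<Rightarrow> nat \<Rightarrow> ((nat \<times> nat) \<times> 'v) set
     \<Rightarrow> ('k::field, (nat \<times> nat) \<times> 'v \<Rightarrow> 'k) persistence_module" where
  "interval_sum lo hi J \<equiv> pm_direct_sum lo hi J (\<lambda>j. interval_module lo hi (fst j))"

lemma interval_sum_simps:
  "pm_first (interval_sum lo hi J) = lo" "pm_last (interval_sum lo hi J) = hi"
  "c \<oplus>\<^bsub>pm_space (interval_sum lo hi J) i\<^esub> c' = (\<lambda>j\<in>J. c j + c' j)"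
  "r \<odot>\<^bsub>pm_space (interval_sum lo hi J) i\<^esub> c = (\<lambda>j\<in>J. r * c j)"
  "pm_map (interval_sum lo hi J) i c =
     (\<lambda>j\<in>J. if fst (fst j) \<le> i \<and> i + 1 \<le> snd (fst j) then c j else 0)"
  by (simp_all add: pm_direct_sum_def interval_module_def)

text \<open>Replaces the case distinction in the carriers of the summands by a condition on the
  support, so that membership is decided by where coordinates are nonzero.\<close>

lemma interval_sum_carrier:
  fixes c :: "(nat \<times> nat) \<times> 'v \<Rightarrow> 'k::field"
  shows "c \<in> carrier (pm_space (interval_sum lo hi J) i) \<longleftrightarrow>
     c \<in> extensional J \<and> finite {j\<in>J. c j \<noteq> 0} \<and>
     (\<forall>j\<in>J. c j \<noteq> 0 \<longrightarrow> fst (fst j) \<le> i \<and> i \<le> snd (fst j))"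
proof -
  have "x \<in> (if P then UNIV else {0}) \<longleftrightarrow> (x \<noteq> 0 \<longrightarrow> P)" for x :: 'k and P :: bool
    by auto
  then show ?thesis
    by (auto simp: pm_direct_sum_def interval_module_def PiE_def Pi_def)
qed

section \<open>Cosets and quotient spaces\<close>

context field_space
begin

definition coset :: "'b set \<Rightarrow> 'b \<Rightarrow> 'b set" where
  "coset G z = {z + b |b. b \<in> G}"

text \<open>Field by field the record of \<open>khomology\<close>, with arbitrary sets in place of
  relative cycles and boundaries, so that homology becomes an instance by unfolding.\<close>

definition quotient :: "'b set \<Rightarrow> 'b set \<Rightarrow> ('a, 'b set) module" where
  "quotient F G =
     \<lparr>carrier = coset G ` F, mult = (\<lambda>_ _. undefined), one = undefined, zero = G,
      add = (\<lambda>A A'. {a + a' |a a'. a \<in> A \<and> a' \<in> A'}),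
      smult = (\<lambda>r A. {scale r a + b |a b. a \<in> A \<and> b \<in> G})\<rparr>"

text \<open>With the space at index \<open>i\<close> being \<open>f (Suc i) / g i\<close>, the step
  from \<open>f p\<close> to \<open>f (Suc p)\<close> is birth at \<open>p\<close>, and the step
  from \<open>g q\<close> to \<open>g (Suc q)\<close> is death on leaving \<open>q\<close>. Hence
  the shifted indices.\<close>

definition pers_codim :: "(nat \<Rightarrow> 'b set) \<Rightarrow> (nat \<Rightarrow> 'b set) \<Rightarrow> nat \<Rightarrow> nat \<Rightarrow> enat" where
  "pers_codim f g p q =
     codim (sum_space (f p \<inter> g (Suc q)) (f (Suc p) \<inter> g q)) (f (Suc p) \<inter> g (Suc q))"

lemma coset_mem: "x \<in> coset G z \<longleftrightarrow> x - z \<in> G"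
  unfolding coset_def by (auto intro: exI[of _ "x - z"])

lemma coset_self: "subspace G \<Longrightarrow> z \<in> coset G z"
  by (simp add: coset_mem subspace_0)

lemma coset_eq: assumes G: "subspace G" shows "coset G x = coset G y \<longleftrightarrow> x - y \<in> G"
proof
  assume "coset G x = coset G y"
  then show "x - y \<in> G" using coset_self[OF G, of x] by (simp add: coset_mem)
next
  assume xy: "x - y \<in> G"
  have "z - x \<in> G \<longleftrightarrow> z - y \<in> G" for z
    using subspace_add[OF G _ xy, of "z - x"] subspace_diff[OF G _ xy, of "z - y"] by auto
  then show "coset G x = coset G y" by (auto simp: coset_mem)
qed

text \<open>The set on the left is how \<open>khom_inclusion\<close> acts on a class; the map keeps
  the representative and enlarges the subspace.\<close>

lemma coset_plus_subspace:
  assumes G: "subspace G" and G': "subspace G'" and sub: "G \<subseteq> G'"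
  shows "{a + b |a b. a \<in> coset G x \<and> b \<in> G'} = coset G' x"
proof (intro Set.set_eqI iffI)
  fix z assume "z \<in> {a + b |a b. a \<in> coset G x \<and> b \<in> G'}"
  then obtain a b where ab: "z = a + b" "a - x \<in> G" "b \<in> G'" by (auto simp: coset_mem)
  then have "(a - x) + b \<in> G'" using sub subspace_add[OF G'] by blast
  then show "z \<in> coset G' x" using ab by (simp add: coset_mem algebra_simps)
next
  fix z assume "z \<in> coset G' x"
  then show "z \<in> {a + b |a b. a \<in> coset G x \<and> b \<in> G'}"
    using coset_self[OF G, of x] unfolding coset_def by blast
qed

lemma quotient_carrier: "carrier (quotient F G) = coset G ` F"
  by (simp add: quotient_def)

lemma quotient_add:
  assumes G: "subspace G"
  shows "coset G x \<oplus>\<^bsub>quotient F G\<^esub> coset G y = coset G (x + y)"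
proof -
  have "z - (x + y) \<in> G \<longleftrightarrow> (\<exists>a a'. z = a + a' \<and> a - x \<in> G \<and> a' - y \<in> G)" for z
  proof
    assume "z - (x + y) \<in> G"
    then show "\<exists>a a'. z = a + a' \<and> a - x \<in> G \<and> a' - y \<in> G"
      using subspace_0[OF G] by (intro exI[of _ x] exI[of _ "z - x"]) (simp add: algebra_simps)
  next
    assume "\<exists>a a'. z = a + a' \<and> a - x \<in> G \<and> a' - y \<in> G"
    then obtain a a' where "z = a + a'" "(a - x) + (a' - y) \<in> G"
      using subspace_add[OF G] by blast
    then show "z - (x + y) \<in> G" by (simp add: algebra_simps)
  qed
  then have "coset G (x + y) = {a + a' |a a'. a - x \<in> G \<and> a' - y \<in> G}"
    by (intro Set.set_eqI) (simp add: coset_mem)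
  then show ?thesis by (simp add: quotient_def coset_mem)
qed

lemma quotient_smult:
  assumes G: "subspace G"
  shows "r \<odot>\<^bsub>quotient F G\<^esub> coset G x = coset G (scale r x)"
proof -
  have "z - scale r x \<in> G \<longleftrightarrow> (\<exists>a b. z = scale r a + b \<and> a - x \<in> G \<and> b \<in> G)" for z
  proof
    assume "z - scale r x \<in> G"
    then show "\<exists>a b. z = scale r a + b \<and> a - x \<in> G \<and> b \<in> G"
      using subspace_0[OF G] by (intro exI[of _ x] exI[of _ "z - scale r x"]) simp
  next
    assume "\<exists>a b. z = scale r a + b \<and> a - x \<in> G \<and> b \<in> G"
    then obtain a b where "z = scale r a + b" "scale r (a - x) + b \<in> G"
      using subspace_add[OF G] subspace_scale[OF G] by blast
    then show "z - scale r x \<in> G" by (simp add: scale_right_diff_distrib algebra_simps)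
  qed
  then have "coset G (scale r x) = {scale r a + b |a b. a - x \<in> G \<and> b \<in> G}"
    by (intro Set.set_eqI) (simp add: coset_mem)
  then show ?thesis by (simp add: quotient_def coset_mem)
qed

text \<open>The first isomorphism theorem, with the map evaluated at a chosen representative of a
  coset. The second conclusion makes the choice invisible, as is needed for commutation with the
  structure maps.\<close>

lemma linear_iso_quotient:
  assumes F: "subspace F" and G: "subspace G" and GF: "G \<subseteq> F"
    and surj: "\<phi> ` F = carrier W"
    and add: "\<And>x y. x \<in> F \<Longrightarrow> y \<in> F \<Longrightarrow> \<phi> (x + y) = \<phi> x \<oplus>\<^bsub>W\<^esub> \<phi> y"
    and smult: "\<And>r x. x \<in> F \<Longrightarrow> \<phi> (scale r x) = r \<odot>\<^bsub>W\<^esub> \<phi> x"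
    and ker: "\<And>x y. x \<in> F \<Longrightarrow> y \<in> F \<Longrightarrow> \<phi> x = \<phi> y \<longleftrightarrow> x - y \<in> G"
  shows "linear_iso (quotient F G) W (\<lambda>A. \<phi> (SOME a. a \<in> A))"
    and "x \<in> F \<Longrightarrow> \<phi> (SOME a. a \<in> coset G x) = \<phi> x"
proof -
  have rep: "\<phi> (SOME a. a \<in> coset G x) = \<phi> x" if x: "x \<in> F" for x
  proof -
    let ?a = "SOME a. a \<in> coset G x"
    have "?a \<in> coset G x" using coset_self[OF G, of x] by (rule someI)
    then have "?a - x \<in> G" by (simp add: coset_mem)
    moreover from this have "?a \<in> F" using GF subspace_add[OF F _ x, of "?a - x"] by auto
    ultimately show ?thesis using ker x by blast
  qed
  then show "x \<in> F \<Longrightarrow> \<phi> (SOME a. a \<in> coset G x) = \<phi> x" .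
  have "inj_on (\<lambda>A. \<phi> (SOME a. a \<in> A)) (coset G ` F)"
    by (rule inj_onI) (auto simp: rep ker coset_eq[OF G, THEN iffD2])
  moreover have "(\<lambda>A. \<phi> (SOME a. a \<in> A)) ` coset G ` F = carrier W"
    unfolding surj[symmetric] by (force simp: rep)
  ultimately show "linear_iso (quotient F G) W (\<lambda>A. \<phi> (SOME a. a \<in> A))"
    unfolding linear_iso_def bij_betw_def
    by (auto simp: quotient_carrier quotient_add[OF G] quotient_smult[OF G] rep add smult
        subspace_add[OF F] subspace_scale[OF F])
qed

text \<open>Coordinates with respect to a part of \<open>E\<close> that already spans
  \<open>x\<close> agree with those with respect to \<open>E\<close>, so basis vectors outside that
  part have coefficient 0.\<close>

lemma representation_support:
  assumes E: "independent E" and x: "x \<in> span (E \<inter> A)" and nz: "representation E x v \<noteq> 0"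
  shows "v \<in> A"
  using representation_extend[OF E x] representation_ne_zero[of "E \<inter> A" x v] nz by auto

end

text \<open>The space at index \<open>i\<close> is \<open>f (i + 1) / g i\<close>, so that \<open>f\<close> starts with \<open>0\<close> before the first
  index and \<open>g\<close> ends with everything after the last one.\<close>

locale flag_quotients = field_space scale
  for scale :: "'a::field \<Rightarrow> 'b::ab_group_add \<Rightarrow> 'b" +
  fixes lo hi :: nat and f g :: "nat \<Rightarrow> 'b set" and M :: "('a, 'b set) persistence_module"
  assumes sf: "subspace (f i)" and sg: "subspace (g i)"
    and mono_f: "mono f" and mono_g: "mono g"
    and f_lo: "f lo = {0}" and f_hi: "f (Suc hi) \<subseteq> g (Suc hi)"
    and g_f: "lo \<le> i \<Longrightarrow> i \<le> hi \<Longrightarrow> g i \<subseteq> f (Suc i)"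
    and first: "pm_first M = lo" and last: "pm_last M = hi"
    and space: "lo \<le> i \<Longrightarrow> i \<le> hi \<Longrightarrow> pm_space M i = quotient (f (Suc i)) (g i)"
    and map: "lo \<le> i \<Longrightarrow> i < hi \<Longrightarrow>
      pm_map M i A = {a + b |a b. a \<in> A \<and> b \<in> g (Suc i)}"
begin

lemma f_mono: "i \<le> j \<Longrightarrow> f i \<subseteq> f j" and g_mono: "i \<le> j \<Longrightarrow> g i \<subseteq> g j"
  using mono_f mono_g by (auto dest: monoD)

lemma map_coset:
  "lo \<le> i \<Longrightarrow> i < hi \<Longrightarrow> pm_map M i (coset (g i) x) = coset (g (Suc i)) x"
  using map coset_plus_subspace[OF sg sg g_mono[of i "Suc i"]] by simp

text \<open>Each vector of an adapted basis enters \<open>f\<close> at one index and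
  \<open>g\<close> at one index. If it enters \<open>g\<close> after its birth, it generates an
  interval; the remaining vectors vanish in every quotient. Taking the coordinates at the vectors
  alive at \<open>i\<close> is the isomorphism.\<close>

lemma interval_decomposition_exists: "\<exists>J. interval_decomposition M J"
proof -
  \<comment> \<open>\<open>adapted_basis\<close> wants both flags to start at 0, which
    \<open>g\<close> need not do. Prepending \<open>{0}\<close> shifts \<open>g\<close> by one,
    hence the bound \<open>Suc (Suc hi)\<close> below.\<close>
  define g' where "g' q = (case q of 0 \<Rightarrow> {0} | Suc q \<Rightarrow> g q)" for q
  have "f 0 = {0}" using f_mono[of 0 lo] f_lo subspace_0[OF sf] by auto
  moreover have "mono g'"
    unfolding g'_def using g_mono[THEN subsetD] subspace_0[OF sg] by (auto intro!: monoI split: nat.splits)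
  moreover have "subspace (g' i)" for i unfolding g'_def using sg by (auto split: nat.splits)
  ultimately obtain E where E: "independent E" "E \<subseteq> f (Suc hi) \<inter> g' (Suc (Suc hi))"
    and "\<forall>p\<le>Suc hi. \<forall>q\<le>Suc (Suc hi). f p \<inter> g' q \<subseteq> span (E \<inter> (f p \<inter> g' q))"
    using adapted_basis[of f g' "Suc hi" "Suc (Suc hi)"] sf mono_f unfolding g'_def by auto
  then have fgE: "f p \<inter> g q \<subseteq> span (E \<inter> (f p \<inter> g q))" if "p \<le> Suc hi" "q \<le> Suc hi" for p q
    using that unfolding g'_def by (metis Suc_le_mono old.nat.simps(5))
  have fE: "f p \<subseteq> span (E \<inter> f p)" if "p \<le> Suc hi" for p
  proof -
    have "f p \<inter> g (Suc hi) = f p" using f_mono[OF that] f_hi by blast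
    then show ?thesis using fgE[OF that, of "Suc hi"] by simp
  qed
  then have fspan: "f p \<subseteq> span E" if "p \<le> Suc hi" for p
    using that span_mono[of "E \<inter> f p" E] by blast
  have gE: "g q \<subseteq> span (E \<inter> g q)" if "lo \<le> q" "q \<le> hi" for q
  proof -
    have "f (Suc q) \<inter> g q = g q" using g_f[OF that] by blast
    then show ?thesis using fgE[of "Suc q" q] that span_mono[of "E \<inter> (f (Suc q) \<inter> g q)" "E \<inter> g q"] by auto
  qed
  \<comment> \<open>The singleton \<open>{v}\<close> is only a label, in the type of cosets.\<close>
  define J where "J = {((p, q), {v}) |p q v. v \<in> E \<and> lo \<le> p \<and> p \<le> q \<and> q \<le> hi \<and>
     v \<in> f (Suc p) - f p \<and> v \<in> g (Suc q) - g q}"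
  have same: "p = p'" if "v \<in> F (Suc p) - F p" "v \<in> F (Suc p') - F p'" "mono F"
    for v p p' and F :: "nat \<Rightarrow> 'b set"
    using that monoD[of F "Suc p" p'] monoD[of F "Suc p'" p] by (metis DiffE Suc_leI in_mono linorder_neqE_nat)
  \<comment> \<open>A vector enters a monotone flag only once, so different summands have different
    generators.\<close>
  have J_inj: "j = j'" if "j \<in> J" "j' \<in> J" "the_elem (snd j) = the_elem (snd j')" for j j'
    using that same[OF _ _ mono_f] same[OF _ _ mono_g] unfolding J_def by fastforce
  define \<phi> where "\<phi> i x = (\<lambda>j\<in>J. if fst (fst j) \<le> i \<and> i \<le> snd (fst j)
    then representation E x (the_elem (snd j)) else 0)" for i x
  let ?N = "interval_sum lo hi J :: ('a, _) persistence_module"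
  have ker0: "(\<forall>j\<in>J. \<phi> i x j = 0) \<longleftrightarrow> x \<in> g i" if i: "lo \<le> i" "i \<le> hi" and x: "x \<in> f (Suc i)" for i x
  proof
    assume x0: "x \<in> g i"
    then have xs: "x \<in> span (E \<inter> g i)" using gE i by blast
    show "\<forall>j\<in>J. \<phi> i x j = 0"
    proof
      fix j assume j: "j \<in> J"
      then obtain p q v where jv: "j = ((p, q), {v})" "v \<notin> g q" unfolding J_def by blast
      have "representation E x v = 0" if "i \<le> q"
        using representation_support[OF E(1) xs, of v] jv(2) g_mono[OF that] by blast
      then show "\<phi> i x j = 0" using j unfolding \<phi>_def jv(1) by simp
    qed
  next
    assume z: "\<forall>j\<in>J. \<phi> i x j = 0"
    have xs: "x \<in> span (E \<inter> f (Suc i))" using fE i x by blast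
    \<comment> \<open>A basis vector in the support of \<open>x\<close> but outside
      \<open>g i\<close> would be born by index \<open>i\<close> and still be alive there, hence
      label a summand on which \<open>\<phi> i x\<close> is nonzero. Its birth and death are the
      least indices at which the flags contain it.\<close>
    have "v \<in> g i" if nz: "representation E x v \<noteq> 0" for v
    proof (rule ccontr)
      assume vg: "v \<notin> g i"
      have vf: "v \<in> f (Suc i)" using representation_support[OF E(1) xs nz] .
      have vE: "v \<in> E" using representation_ne_zero[OF nz] .
      have v0: "v \<noteq> 0" using vE E(1) dependent_zero by blast
      define p where "p = (LEAST p. v \<in> f (Suc p))"
      have p: "v \<in> f (Suc p)" "p \<le> i"
        unfolding p_def using vf by (auto intro: LeastI Least_le)
      have "v \<notin> f p"
      proof
        assume "v \<in> f p"
        show False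
        proof (cases p)
          case 0
          then show False using \<open>v \<in> f p\<close> \<open>f 0 = {0}\<close> v0 by simp
        next
          case (Suc p')
          then show False using \<open>v \<in> f p\<close> not_less_Least[of p' "\<lambda>p. v \<in> f (Suc p)"] p_def by simp
        qed
      qed
      moreover have "lo \<le> p"
        using p(1) f_mono[of "Suc p" lo] f_lo v0 by (cases "lo \<le> p") auto
      moreover define q where "q = (LEAST q. v \<in> g (Suc q))"
      have vh: "v \<in> g (Suc hi)" using vf f_mono[of "Suc i" "Suc hi"] i f_hi by blast
      have q: "v \<in> g (Suc q)" "q \<le> hi"
        unfolding q_def using vh by (auto intro: LeastI Least_le)
      have iq: "i \<le> q" using vg g_mono[of "Suc q" i] q(1) by (cases "i \<le> q") auto
      moreover have "v \<notin> g q"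
      proof
        assume "v \<in> g q"
        show False
        \<comment> \<open>Minimality of \<open>q\<close> excludes only members of the form
          \<open>g (Suc q')\<close>. The value \<open>q = 0\<close> forces \<open>i = 0\<close>, and
          there \<open>v \<notin> g i\<close> applies.\<close>
        proof (cases "q = i")
          case True
          then show False using \<open>v \<in> g q\<close> vg by simp
        next
          case False
          then obtain q' where "q = Suc q'" using iq by (cases q) auto
          then show False using \<open>v \<in> g q\<close> not_less_Least[of q' "\<lambda>q. v \<in> g (Suc q)"] q_def by simp
        qed
      qed
      ultimately have jJ: "((p, q), {v}) \<in> J" unfolding J_def using p q vE by auto
      then have "\<phi> i x ((p, q), {v}) = representation E x v" unfolding \<phi>_def using p iq by simp
      then show False using z jJ nz by auto
    qed
    then have "(\<Sum>b | representation E x b \<noteq> 0. scale (representation E x b) b) \<in> g i"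
      by (intro subspace_sum subspace_scale sg) auto
    then show "x \<in> g i"
      using sum_nonzero_representation_eq[OF E(1), of x] fspan[of "Suc i"] i x by auto
  qed
  have iso: "linear_iso (pm_space M i) (pm_space ?N i) (\<lambda>A. \<phi> i (SOME a. a \<in> A))"
    and rep: "x \<in> f (Suc i) \<Longrightarrow> \<phi> i (SOME a. a \<in> coset (g i) x) = \<phi> i x"
    if i: "lo \<le> i" "i \<le> hi" for i x
  proof -
    have sp: "x \<in> span E" if "x \<in> f (Suc i)" for x using fspan[of "Suc i"] i that by auto
    have surj: "\<phi> i ` f (Suc i) = carrier (pm_space ?N i)"
    proof (intro Set.set_eqI iffI)
      fix c assume "c \<in> \<phi> i ` f (Suc i)"
      then obtain x where c: "c = \<phi> i x" by blast
      have "inj_on (\<lambda>j. the_elem (snd j)) {j\<in>J. \<phi> i x j \<noteq> 0}"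
        by (rule inj_onI) (simp add: J_inj)
      moreover have "(\<lambda>j. the_elem (snd j)) ` {j\<in>J. \<phi> i x j \<noteq> 0} \<subseteq> {b. representation E x b \<noteq> 0}"
        unfolding \<phi>_def by auto
      ultimately have "finite {j\<in>J. \<phi> i x j \<noteq> 0}"
        using finite_representation[of E x] by (metis (no_types) finite_imageD finite_subset)
      then show "c \<in> carrier (pm_space ?N i)"
        unfolding interval_sum_carrier c by (auto simp: \<phi>_def split: if_splits)
    next
      fix c assume "c \<in> carrier (pm_space ?N i)"
      then have c: "c \<in> extensional J" "finite {j\<in>J. c j \<noteq> 0}"
        "\<And>j. j \<in> J \<Longrightarrow> c j \<noteq> 0 \<Longrightarrow> fst (fst j) \<le> i \<and> i \<le> snd (fst j)"
        unfolding interval_sum_carrier by auto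
      let ?K = "{j\<in>J. c j \<noteq> 0}" and ?v = "\<lambda>j. the_elem (snd j)"
      \<comment> \<open>The lift of \<open>c\<close> is the combination of the generators with the
        entries of \<open>c\<close> as coefficients.\<close>
      define x where "x = (\<Sum>j\<in>?K. scale (c j) (?v j))"
      have vE: "?v j \<in> E" if "j \<in> J" for j using that unfolding J_def by auto
      have "?v j \<in> f (Suc i)" if "j \<in> ?K" for j
      proof -
        obtain p q v where jv: "j = ((p, q), {v})" "v \<in> f (Suc p)" using \<open>j \<in> ?K\<close> unfolding J_def by blast
        then have "p \<le> i" using c(3)[of j] that by auto
        then show ?thesis using jv f_mono[of "Suc p" "Suc i"] by auto
      qed
      then have x: "x \<in> f (Suc i)" unfolding x_def by (intro subspace_sum subspace_scale sf) auto
      have repx: "representation E x = (\<lambda>b. \<Sum>j\<in>?K. representation E (scale (c j) (?v j)) b)"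
        unfolding x_def by (rule representation_sum[OF E(1)]) (use vE in \<open>simp add: span_scale span_base\<close>)
      have "representation E x (?v j) = c j" if j: "j \<in> J" for j
      proof -
        have "representation E x (?v j) = (\<Sum>j'\<in>?K. if j' = j then c j' else 0)"
          unfolding repx
        proof (rule sum.cong[OF refl])
          fix j' assume j': "j' \<in> ?K"
          then have "representation E (scale (c j') (?v j')) (?v j) = c j' * (if ?v j = ?v j' then 1 else 0)"
            using vE[of j'] by (simp add: representation_scale[OF E(1)] span_base representation_basis[OF E(1)])
          then show "representation E (scale (c j') (?v j')) (?v j) = (if j' = j then c j' else 0)"
            using J_inj[of j j'] j j' by auto
        qed
        also have "\<dots> = c j" using c(2) j by (simp add: sum.delta)
        finally show ?thesis .
      qed
      then have "\<phi> i x j = c j" if "j \<in> J" for j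
        using c(3)[of j] that unfolding \<phi>_def by auto
      then have "\<phi> i x = c"
        using c(1) by (intro extensionalityI[of _ J]) (simp_all add: \<phi>_def)
      then show "c \<in> \<phi> i ` f (Suc i)" using x by blast
    qed
    have add: "\<phi> i (x + y) = \<phi> i x \<oplus>\<^bsub>pm_space ?N i\<^esub> \<phi> i y" if "x \<in> f (Suc i)" "y \<in> f (Suc i)" for x y
      unfolding interval_sum_simps \<phi>_def
      by (auto simp: representation_add[OF E(1) sp[OF that(2)] sp[OF that(1)]] intro!: restrict_ext)
    have smult: "\<phi> i (scale r x) = r \<odot>\<^bsub>pm_space ?N i\<^esub> \<phi> i x" if "x \<in> f (Suc i)" for r x
      unfolding interval_sum_simps \<phi>_def
      by (auto simp: representation_scale[OF E(1) sp[OF that]] intro!: restrict_ext)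
    have ker: "\<phi> i x = \<phi> i y \<longleftrightarrow> x - y \<in> g i" if xy: "x \<in> f (Suc i)" "y \<in> f (Suc i)" for x y
    proof -
      have d: "\<phi> i (x - y) j = \<phi> i x j - \<phi> i y j" if "j \<in> J" for j
        using that representation_diff[OF E(1) sp[OF xy(2)] sp[OF xy(1)]] unfolding \<phi>_def by auto
      have "\<phi> i x = \<phi> i y \<longleftrightarrow> (\<forall>j\<in>J. \<phi> i x j = \<phi> i y j)"
      proof -
        have "\<phi> i x \<in> extensional J" "\<phi> i y \<in> extensional J" by (simp_all add: \<phi>_def)
        then show ?thesis by (auto intro: extensionalityI[of _ J])
      qed
      also have "\<dots> \<longleftrightarrow> (\<forall>j\<in>J. \<phi> i (x - y) j = 0)" using d by auto
      also have "\<dots> \<longleftrightarrow> x - y \<in> g i" using ker0[OF i] subspace_diff[OF sf] xy by blast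
      finally show ?thesis .
    qed
    note li = linear_iso_quotient[OF sf sg g_f[OF i] surj add smult ker]
    show "linear_iso (pm_space M i) (pm_space ?N i) (\<lambda>A. \<phi> i (SOME a. a \<in> A))"
      unfolding space[OF i] by (rule li(1))
    show "x \<in> f (Suc i) \<Longrightarrow> \<phi> i (SOME a. a \<in> coset (g i) x) = \<phi> i x"
      by (rule li(2))
  qed
  have comm: "\<phi> (i + 1) (SOME a. a \<in> pm_map M i A) = pm_map ?N i (\<phi> i (SOME a. a \<in> A))"
    if i: "lo \<le> i" "i < hi" and A: "A \<in> carrier (pm_space M i)" for i A
  proof -
    obtain x where x: "x \<in> f (Suc i)" "A = coset (g i) x"
      using A i by (auto simp: space quotient_carrier)
    have x': "x \<in> f (Suc (Suc i))" using x f_mono[of "Suc i" "Suc (Suc i)"] by auto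
    have "\<phi> (i + 1) (SOME a. a \<in> pm_map M i A) = \<phi> (Suc i) x"
      using rep[of "Suc i" x] x' i by (simp add: x(2) map_coset)
    moreover have "\<phi> i (SOME a. a \<in> A) = \<phi> i x" using rep[of i x] x i by simp
    moreover have "\<phi> (Suc i) x j = (if fst (fst j) \<le> i \<and> i + 1 \<le> snd (fst j) then \<phi> i x j else 0)"
      if j: "j \<in> J" for j
    proof -
      obtain p q v where jv: "j = ((p, q), {v})" "v \<notin> f p" using j unfolding J_def by blast
      \<comment> \<open>The two sides could differ only on a summand that begins at
        \<open>Suc i\<close>. Its generator lies outside \<open>f (Suc i)\<close>, so
        \<open>x\<close> has coordinate 0 there.\<close>
      have "representation E x v = 0" if "p = Suc i"
        using representation_support[OF E(1), of x "f (Suc i)" v] fE[of "Suc i"] x(1) i jv(2) that by auto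
      then show ?thesis using j unfolding \<phi>_def jv(1) by auto
    qed
    moreover have "\<phi> (Suc i) x \<in> extensional J" unfolding \<phi>_def by simp
    ultimately show ?thesis
      unfolding interval_sum_simps by (auto intro!: extensionalityI[of _ J])
  qed
  have "pm_isomorphic M ?N"
    unfolding pm_isomorphic_def interval_sum_simps(1,2) first last
    using iso comm by (intro conjI refl exI[of _ "\<lambda>i A. \<phi> i (SOME a. a \<in> A)"]) auto
  then have "interval_decomposition M J"
    unfolding interval_decomposition_def first last J_def by auto
  then show ?thesis ..
qed


text \<open>In the coordinates of any decomposition, \<open>g d\<close> and \<open>f p + g p\<close>
  are cut out by the vanishing of coordinates of intervals reaching \<open>d\<close>, respectively
  starting at \<open>p\<close>. So lifts of the generators of the summands \<open>[p, q]\<close>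
  form a basis of the quotient that \<open>pers_codim\<close> measures.\<close>

lemma interval_decomposition_multiplicity:
  assumes dec: "interval_decomposition M J" and pq: "lo \<le> p" "p \<le> q" "q \<le> hi"
  shows "ecard {v. ((p, q), v) \<in> J} = pers_codim f g p q"
proof -
  let ?N = "interval_sum lo hi J :: ('a, _) persistence_module"
  have Jb: "lo \<le> fst (fst j) \<and> fst (fst j) \<le> snd (fst j) \<and> snd (fst j) \<le> hi" if "j \<in> J" for j
    using dec that unfolding interval_decomposition_def first last by fastforce
  have "pm_isomorphic M ?N" using dec unfolding interval_decomposition_def first last by simp
  then obtain h where h': "\<forall>i\<in>{lo..hi}. linear_iso (pm_space M i) (pm_space ?N i) (h i)"
    "\<forall>i\<in>{lo..<hi}. \<forall>A\<in>carrier (pm_space M i). h (i + 1) (pm_map M i A) = pm_map ?N i (h i A)"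
    unfolding pm_isomorphic_def first last by blast
  have h: "linear_iso (pm_space M i) (pm_space ?N i) (h i)" if "lo \<le> i" "i \<le> hi" for i
    using h'(1) that by simp
  have hc: "h (i + 1) (pm_map M i A) = pm_map ?N i (h i A)"
    if "lo \<le> i" "i < hi" "A \<in> carrier (pm_space M i)" for i A
    using h'(2) that by simp
  define \<phi> where "\<phi> i x = h i (coset (g i) x)" for i x
  have im: "\<phi> i ` f (Suc i) = carrier (pm_space ?N i)" if i: "lo \<le> i" "i \<le> hi" for i
    using h[OF i] unfolding linear_iso_def bij_betw_def space[OF i] quotient_carrier \<phi>_def
    by (simp add: image_image)
  have mem: "\<phi> i x \<in> carrier (pm_space ?N i)" if "lo \<le> i" "i \<le> hi" "x \<in> f (Suc i)" for i x
    using im that by blast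
  have supp: "fst (fst j) \<le> i \<and> i \<le> snd (fst j)"
    if "lo \<le> i" "i \<le> hi" "x \<in> f (Suc i)" "j \<in> J" "\<phi> i x j \<noteq> 0" for i x j
    using mem[OF that(1-3)] that(4,5) unfolding interval_sum_carrier by blast
  have add: "\<phi> i (x + y) j = \<phi> i x j + \<phi> i y j"
    if i: "lo \<le> i" "i \<le> hi" and "x \<in> f (Suc i)" "y \<in> f (Suc i)" "j \<in> J" for i x y j
  proof -
    have "h i (coset (g i) x \<oplus>\<^bsub>pm_space M i\<^esub> coset (g i) y) =
        h i (coset (g i) x) \<oplus>\<^bsub>pm_space ?N i\<^esub> h i (coset (g i) y)"
      using h[OF i] that unfolding linear_iso_def by (simp add: space[OF i] quotient_carrier)
    then show ?thesis
      using that unfolding \<phi>_def interval_sum_simps by (simp add: space[OF i] quotient_add[OF sg])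
  qed
  have smult: "\<phi> i (scale r x) j = r * \<phi> i x j"
    if i: "lo \<le> i" "i \<le> hi" and "x \<in> f (Suc i)" "j \<in> J" for i r x j
  proof -
    have "h i (r \<odot>\<^bsub>pm_space M i\<^esub> coset (g i) x) = r \<odot>\<^bsub>pm_space ?N i\<^esub> h i (coset (g i) x)"
      using h[OF i] that unfolding linear_iso_def by (simp add: space[OF i] quotient_carrier)
    then show ?thesis
      using that unfolding \<phi>_def interval_sum_simps by (simp add: space[OF i] quotient_smult[OF sg])
  qed
  have zero: "\<phi> i 0 j = 0" if "lo \<le> i" "i \<le> hi" "j \<in> J" for i j
    using smult[OF that(1,2) subspace_0[OF sf] that(3), of 0] by simp
  have diff: "\<phi> i (x - y) j = \<phi> i x j - \<phi> i y j"
    if i: "lo \<le> i" "i \<le> hi" and xy: "x \<in> f (Suc i)" "y \<in> f (Suc i)" and "j \<in> J" for i x y j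
    using add[OF i subspace_diff[OF sf xy] xy(2) \<open>j \<in> J\<close>] by simp
  have ker: "\<phi> i x = \<phi> i y \<longleftrightarrow> x - y \<in> g i"
    if i: "lo \<le> i" "i \<le> hi" and xy: "x \<in> f (Suc i)" "y \<in> f (Suc i)" for i x y
  proof -
    have "inj_on (h i) (coset (g i) ` f (Suc i))"
      using h[OF i] unfolding linear_iso_def bij_betw_def by (simp add: space[OF i] quotient_carrier)
    then show ?thesis
      unfolding \<phi>_def using xy coset_eq[OF sg] by (metis image_eqI inj_onD)
  qed
  have ker0: "x \<in> g i \<longleftrightarrow> (\<forall>j\<in>J. \<phi> i x j = 0)"
    if i: "lo \<le> i" "i \<le> hi" and x: "x \<in> f (Suc i)" for i x
  proof -
    have "x \<in> g i \<longleftrightarrow> \<phi> i x = \<phi> i 0" using ker[OF i x subspace_0[OF sf]] by simp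
    also have "\<dots> \<longleftrightarrow> (\<forall>j\<in>J. \<phi> i x j = \<phi> i 0 j)"
      using mem[OF i x] mem[OF i subspace_0[OF sf]] unfolding interval_sum_carrier
      by (auto intro: extensionalityI[of _ J])
    finally show ?thesis using zero[OF i] by simp
  qed
  have shift: "\<phi> (Suc i) x j = (if fst (fst j) \<le> i \<and> Suc i \<le> snd (fst j) then \<phi> i x j else 0)"
    if "lo \<le> i" "i < hi" "x \<in> f (Suc i)" "j \<in> J" for i x j
    using hc[of i "coset (g i) x"] that
    by (simp add: \<phi>_def space quotient_carrier map_coset interval_sum_simps)
  \<comment> \<open>A coordinate stays constant until its interval ends and is 0 afterwards. The
    coordinates at the birth index thus decide membership in all later \<open>g d\<close>.\<close>
  have carry: "\<phi> i x j = (if i \<le> snd (fst j) then \<phi> b x j else 0)"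
    if "lo \<le> b" "b \<le> i" "i \<le> hi" "x \<in> f (Suc b)" "j \<in> J" for b i x j
    using that(2,3)
  proof (induction i rule: dec_induct)
    case base
    then show ?case using supp[of b x j] that by auto
  next
    case (step i)
    then have "x \<in> f (Suc i)" using that(4) f_mono[of "Suc b" "Suc i"] by auto
    then have "\<phi> (Suc i) x j = (if fst (fst j) \<le> i \<and> Suc i \<le> snd (fst j) then \<phi> b x j else 0)"
      using step shift[of i x j] that(1,5) by auto
    moreover have "fst (fst j) \<le> i" if "\<phi> b x j \<noteq> 0"
      using supp[of b x j] step \<open>lo \<le> b\<close> \<open>x \<in> f (Suc b)\<close> \<open>j \<in> J\<close> that by linarith
    ultimately show ?case by auto
  qed
  have death: "x \<in> g d \<longleftrightarrow> (\<forall>j\<in>J. d \<le> snd (fst j) \<longrightarrow> \<phi> p x j = 0)"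
    if "p \<le> d" "d \<le> Suc hi" "x \<in> f (Suc p)" for d x
  \<comment> \<open>There is no space at \<open>Suc hi\<close>. Both sides hold there:
    \<open>f_hi\<close> puts everything into \<open>g (Suc hi)\<close>, and no interval reaches that
    far.\<close>
  proof (cases "d = Suc hi")
    case True
    have "x \<in> g (Suc hi)" using that pq f_mono[of "Suc p" "Suc hi"] f_hi by auto
    then show ?thesis using True Jb by fastforce
  next
    case False
    then have d: "lo \<le> d" "d \<le> hi" using that pq by auto
    have "x \<in> f (Suc d)" using that f_mono[of "Suc p" "Suc d"] by auto
    then have "x \<in> g d \<longleftrightarrow> (\<forall>j\<in>J. \<phi> d x j = 0)" using ker0[OF d] by simp
    then show ?thesis using carry[of p d x] that d pq by auto
  qed
  have p: "lo \<le> p" "p \<le> hi" using pq by auto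
  \<comment> \<open>Modulo \<open>g p\<close>, the space \<open>f p\<close> is the image of the
    incoming map, or 0 at the first index. In a sum of intervals that image consists of the vectors
    without coordinates at intervals starting at \<open>p\<close>.\<close>
  have birth: "x \<in> sum_space (f p) (g p) \<longleftrightarrow> (\<forall>j\<in>J. fst (fst j) = p \<longrightarrow> \<phi> p x j = 0)"
    if x: "x \<in> f (Suc p)" for x
  proof
    assume "x \<in> sum_space (f p) (g p)"
    then obtain y z where yz: "x = y + z" "y \<in> f p" "z \<in> g p" unfolding sum_space_def by blast
    have y: "y \<in> f (Suc p)" and z: "z \<in> f (Suc p)"
      using yz f_mono[of p "Suc p"] g_f[OF p] by auto
    show "\<forall>j\<in>J. fst (fst j) = p \<longrightarrow> \<phi> p x j = 0"
    proof (intro ballI impI)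
      fix j assume j: "j \<in> J" "fst (fst j) = p"
      have "\<phi> p z j = 0" using ker0[OF p z] yz(3) j by blast
      moreover have "\<phi> p y j = 0"
      proof (cases "p = lo")
        case True
        then show ?thesis using yz(2) f_lo zero[OF p] j by simp
      next
        case False
        then obtain p' where p': "p = Suc p'" "lo \<le> p'" using p by (cases p) auto
        then show ?thesis using shift[of p' y j] yz(2) j p by simp
      qed
      ultimately show "\<phi> p x j = 0" using add[OF p y z j(1)] yz(1) by simp
    qed
  next
    assume x0: "\<forall>j\<in>J. fst (fst j) = p \<longrightarrow> \<phi> p x j = 0"
    show "x \<in> sum_space (f p) (g p)"
    proof (cases "p = lo")
      case True
      have "\<phi> p x j = 0" if "j \<in> J" for j
        using supp[OF p x that] x0 that Jb[OF that] True by force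
      then have "x \<in> g p" using ker0[OF p x] by blast
      then show ?thesis using sum_space_upper2[OF sf] by blast
    next
      case False
      then obtain p' where p': "p = Suc p'" "lo \<le> p'" "p' < hi" using p by (cases p) auto
      have "fst (fst j) \<le> p' \<and> p' \<le> snd (fst j)" if "j \<in> J" "\<phi> p x j \<noteq> 0" for j
        using supp[OF p x that] x0 that p' by force
      then have "\<phi> p x \<in> carrier (pm_space ?N p')"
        using mem[OF p x] unfolding interval_sum_carrier by blast
      then obtain y where y: "y \<in> f p" "\<phi> p' y = \<phi> p x"
        using im[of p'] p' by (metis image_iff less_imp_le)
      have y': "y \<in> f (Suc p)" using y f_mono[of p "Suc p"] by auto
      have "\<phi> p x j = \<phi> p y j" if j: "j \<in> J" for j
        using shift[of p' y j] y p' j supp[OF p x j] x0 by force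
      then have "\<phi> p (x - y) j = 0" if "j \<in> J" for j using diff[OF p x y' that] that by simp
      then have "x - y \<in> g p" using ker0[OF p subspace_diff[OF sf x y']] by blast
      then show ?thesis using y sum_spaceI[of y "f p" "x - y" "g p"] by simp
    qed
  qed
  define V where "V = {v. ((p, q), v) \<in> J}"
  define A where "A = f (Suc p) \<inter> g (Suc q)"
  define U where "U = sum_space (f p \<inter> g (Suc q)) (f (Suc p) \<inter> g q)"
  have sA: "subspace A" and sU: "subspace U"
    unfolding A_def U_def by (intro subspace_sum_space subspace_inter sf sg)+
  have UA: "U \<subseteq> A" unfolding U_def A_def using f_mono[of p "Suc p"] g_mono[of q "Suc q"]
    by (intro sum_space_least subspace_inter sf sg) auto
  have U0: "\<phi> p x ((p, q), v) = 0" if xU: "x \<in> U" and v: "v \<in> V" for x v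
  proof -
    obtain y z where yz: "x = y + z" "y \<in> f p" "z \<in> f (Suc p)" "z \<in> g q"
      using xU unfolding U_def sum_space_def by blast
    have y: "y \<in> f (Suc p)" using yz f_mono[of p "Suc p"] by auto
    have j: "((p, q), v) \<in> J" using v unfolding V_def by simp
    have "y \<in> sum_space (f p) (g p)" using yz sum_space_upper1[OF sg] by blast
    then have "\<phi> p y ((p, q), v) = 0" using birth[OF y] j by auto
    moreover have "\<phi> p z ((p, q), v) = 0" using death[of q z] yz pq j by auto
    ultimately show ?thesis using add[OF p y yz(3) j] yz(1) by simp
  qed
  have "\<exists>x. x \<in> f (Suc p) \<and> \<phi> p x = (\<lambda>j\<in>J. if j = ((p, q), v) then 1 else 0)" if "v \<in> V" for v
  proof -
    have "(\<lambda>j\<in>J. if j = ((p, q), v) then 1 else 0) \<in> carrier (pm_space ?N p)"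
      unfolding interval_sum_carrier using pq
      by (auto intro: finite_subset[of _ "{((p, q), v)}"] split: if_splits)
    then have "(\<lambda>j\<in>J. if j = ((p, q), v) then 1 else 0) \<in> \<phi> p ` f (Suc p)" using im[OF p] by simp
    then show ?thesis by (auto elim!: imageE)
  qed
  then have "\<forall>v\<in>V. \<exists>x. x \<in> f (Suc p) \<and> \<phi> p x = (\<lambda>j\<in>J. if j = ((p, q), v) then 1 else 0)"
    by blast
  from bchoice[OF this] obtain X where X: "\<And>v. v \<in> V \<Longrightarrow> X v \<in> f (Suc p)"
    "\<And>v. v \<in> V \<Longrightarrow> \<phi> p (X v) = (\<lambda>j\<in>J. if j = ((p, q), v) then 1 else 0)"
    by blast
  have XA: "X v \<in> A" if "v \<in> V" for v
  proof -
    \<comment> \<open>The only nonzero coordinate of \<open>X v\<close> belongs to an interval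
      ending at \<open>q\<close>.\<close>
    have "X v \<in> g (Suc q)" using death[of "Suc q" "X v"] X[OF that] pq by auto
    then show ?thesis unfolding A_def using X[OF that] by simp
  qed
  have coord: "\<phi> p (\<Sum>v\<in>t. scale (u v) (X v)) j = (\<Sum>v\<in>t. if j = ((p, q), v) then u v else 0)"
    and coord_mem: "(\<Sum>v\<in>t. scale (u v) (X v)) \<in> A"
    if "finite t" "t \<subseteq> V" "j \<in> J" for t u j
  proof -
    show m: "(\<Sum>v\<in>t. scale (u v) (X v)) \<in> A"
      by (intro subspace_sum subspace_scale sA) (use XA that in auto)
    show "\<phi> p (\<Sum>v\<in>t. scale (u v) (X v)) j = (\<Sum>v\<in>t. if j = ((p, q), v) then u v else 0)"
      using that(1,2)
    proof (induction t)
      case empty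
      then show ?case using zero[OF p that(3)] by simp
    next
      case (insert v t)
      have "(\<Sum>v\<in>t. scale (u v) (X v)) \<in> f (Suc p)"
        by (intro subspace_sum subspace_scale sf) (use X insert in auto)
      then show ?case
        using insert X add[OF p subspace_scale[OF sf X(1)] _ that(3)] smult[OF p X(1) that(3)] that(3)
        by simp
    qed
  qed
  have inj: "inj_on X V"
  proof (rule inj_onI)
    fix v w assume vw: "v \<in> V" "w \<in> V" "X v = X w"
    then have "\<phi> p (X v) ((p, q), v) = \<phi> p (X w) ((p, q), v)" by simp
    then show "v = w" using X(2)[OF vw(1)] X(2)[OF vw(2)] vw(1) by (auto simp: V_def split: if_splits)
  qed
  \<comment> \<open>The coordinates at the summands \<open>[p, q]\<close> vanish on \<open>U\<close>
    and recover the coefficients of a combination of the lifts. This gives independence, as 0 is in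
    \<open>U\<close>, as well as trivial intersection with \<open>U\<close>.\<close>
  have U_coord: "u v = 0" if "finite t" "t \<subseteq> V" "(\<Sum>v\<in>t. scale (u v) (X v)) \<in> U" "v \<in> t" for t u v
  proof -
    have j: "((p, q), v) \<in> J" using that unfolding V_def by auto
    have "(\<Sum>w\<in>t. if ((p, q), v) = ((p, q), w) then u w else 0) = 0"
      using coord[OF that(1,2) j, of u] U0[OF that(3), of v] that by auto
    then show ?thesis using that by (simp add: sum.delta')
  qed
  have img: "\<exists>t u. finite t \<and> t \<subseteq> V \<and> s = X ` t \<and> (\<Sum>x\<in>s. scale (r x) x) = (\<Sum>v\<in>t. scale (u v) (X v)) \<and> u = r \<circ> X"
    if fin: "finite s" and sub: "s \<subseteq> X ` V" for s r
  proof -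
    obtain t where t: "t \<subseteq> V" "s = X ` t" using sub by (rule subset_imageE)
    then have "inj_on X t" using inj inj_on_subset by blast
    then show ?thesis using t fin by (intro exI[of _ t] exI[of _ "r \<circ> X"])
        (auto simp: sum.reindex finite_image_iff)
  qed
  have "independent (X ` V)"
  proof
    assume "dependent (X ` V)"
    then obtain s r x where s: "finite s" "s \<subseteq> X ` V" "(\<Sum>x\<in>s. scale (r x) x) = 0" "x \<in> s" "r x \<noteq> 0"
      unfolding dependent_explicit by force
    obtain t where t: "finite t" "t \<subseteq> V" "s = X ` t" "(\<Sum>v\<in>t. scale ((r \<circ> X) v) (X v)) = 0"
      using img[OF s(1,2), of r] s(3) by auto
    then show False using U_coord[OF t(1,2), of "r \<circ> X"] subspace_0[OF sU] s(4,5) by auto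
  qed
  moreover have "span (X ` V) \<inter> U \<subseteq> {0}"
  proof
    fix x assume x: "x \<in> span (X ` V) \<inter> U"
    then obtain s r where s: "finite s" "s \<subseteq> X ` V" "x = (\<Sum>x\<in>s. scale (r x) x)"
      unfolding span_explicit by auto
    obtain t where t: "finite t" "t \<subseteq> V" "s = X ` t" "x = (\<Sum>v\<in>t. scale ((r \<circ> X) v) (X v))"
      using img[OF s(1,2), of r] s(3) by auto
    have "(r \<circ> X) v = 0" if "v \<in> t" for v
      by (rule U_coord[OF t(1,2) _ that]) (use x t(4) in simp)
    then show "x \<in> {0}" using t(4) by simp
  qed
  moreover have "x \<in> span (U \<union> X ` V)" if x: "x \<in> A" for x
  proof -
    have xf: "x \<in> f (Suc p)" and xg: "x \<in> g (Suc q)" using x unfolding A_def by auto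
    define K where "K = {v \<in> V. \<phi> p x ((p, q), v) \<noteq> 0}"
    have "finite {j\<in>J. \<phi> p x j \<noteq> 0}" using mem[OF p xf] unfolding interval_sum_carrier by blast
    moreover have "(\<lambda>v. ((p, q), v)) ` K \<subseteq> {j\<in>J. \<phi> p x j \<noteq> 0}" unfolding K_def V_def by auto
    ultimately have "finite ((\<lambda>v. ((p, q), v)) ` K)" by (rule rev_finite_subset)
    then have fK: "finite K" by (rule finite_imageD) (simp add: inj_on_def)
    have KV: "K \<subseteq> V" unfolding K_def by auto
    \<comment> \<open>Subtracting \<open>s\<close> removes all coordinates at the summands
      \<open>[p, q]\<close>; the remainder is to be placed in \<open>U\<close>.\<close>
    define s where "s = (\<Sum>v\<in>K. scale (\<phi> p x ((p, q), v)) (X v))"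
    have sA': "s \<in> A" unfolding s_def by (intro subspace_sum subspace_scale sA) (use XA KV in auto)
    then have sf': "s \<in> f (Suc p)" unfolding A_def by simp
    have yA: "x - s \<in> A" using subspace_diff[OF sA x sA'] .
    then have yf: "x - s \<in> f (Suc p)" and yg: "x - s \<in> g (Suc q)" unfolding A_def by auto
    have y0: "\<phi> p (x - s) ((p, q), v) = 0" if v: "v \<in> V" for v
    proof -
      have j: "((p, q), v) \<in> J" using v unfolding V_def by simp
      have "\<phi> p s ((p, q), v) = (\<Sum>w\<in>K. if v = w then \<phi> p x ((p, q), w) else 0)"
        unfolding s_def using coord[OF fK KV j] by simp
      also have "\<dots> = \<phi> p x ((p, q), v)" using fK v unfolding K_def by (simp add: sum.delta')
      finally show ?thesis using diff[OF p xf sf' j] by simp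
    qed
    \<comment> \<open>The remaining coordinates born at \<open>p\<close>. They belong to intervals
      ending before \<open>q\<close>: later ends are excluded by \<open>g (Suc q)\<close>, and an
      end at \<open>q\<close> by the choice of \<open>s\<close>. Hence their lift \<open>z\<close>
      lies in \<open>g q\<close>.\<close>
    let ?c = "\<lambda>j\<in>J. if fst (fst j) = p then \<phi> p (x - s) j else 0"
    have "?c \<in> carrier (pm_space ?N p)"
      unfolding interval_sum_carrier
    proof (intro conjI ballI)
      show "finite {j \<in> J. ?c j \<noteq> 0}"
        using mem[OF p yf] unfolding interval_sum_carrier
        by (auto intro: finite_subset[of _ "{j\<in>J. \<phi> p (x - s) j \<noteq> 0}"])
    qed (use supp[OF p yf] in \<open>auto split: if_splits\<close>)
    then have "?c \<in> \<phi> p ` f (Suc p)" using im[OF p] by simp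
    then obtain z where z: "z \<in> f (Suc p)" "\<phi> p z = ?c" by (auto elim!: imageE)
    have "z \<in> g q"
    proof -
      have "\<phi> p z j = 0" if j: "j \<in> J" "q \<le> snd (fst j)" for j
      proof (rule ccontr)
        assume nz: "\<phi> p z j \<noteq> 0"
        then have 1: "fst (fst j) = p" "\<phi> p (x - s) j \<noteq> 0" using j by (auto simp: z(2) split: if_splits)
        then have "\<not> Suc q \<le> snd (fst j)" using death[of "Suc q" "x - s"] yf yg j pq by auto
        then have "j = ((p, q), snd j)" using 1 j by (simp add: prod_eq_iff)
        then show False using y0[of "snd j"] 1 j unfolding V_def by auto
      qed
      then show ?thesis using death[of q z] z pq by auto
    qed
    have yz: "x - s - z \<in> f (Suc p)" using subspace_diff[OF sf yf z(1)] .
    have "\<phi> p (x - s - z) j = 0" if "j \<in> J" "fst (fst j) = p" for j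
      using diff[OF p yf z(1) that(1)] that z(2) by simp
    then have "x - s - z \<in> sum_space (f p) (g p)" using birth[OF yz] by blast
    then obtain w w' where w: "x - s - z = w + w'" "w \<in> f p" "w' \<in> g p"
      unfolding sum_space_def by blast
    \<comment> \<open>The regrouping \<open>w + (w' + z)\<close> fits the two summands of
      \<open>U\<close>: \<open>w'\<close> is in \<open>g p\<close>, hence in \<open>g q\<close>, and
      \<open>w\<close> is in \<open>g (Suc q)\<close> as a difference of members.\<close>
    have wf: "w' + z \<in> f (Suc p)" using w z g_f[OF p] subspace_add[OF sf] by blast
    have wg: "w' + z \<in> g q" using w \<open>z \<in> g q\<close> g_mono[OF pq(2)] subspace_add[OF sg] by blast
    have weq: "w = (x - s) - (w' + z)" using w(1) by (simp add: algebra_simps)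
    have "w' + z \<in> g (Suc q)" using wg g_mono[of q "Suc q"] by auto
    then have "w \<in> g (Suc q)" unfolding weq using yg subspace_diff[OF sg] by blast
    then have "w + (w' + z) \<in> U" unfolding U_def using w wf wg by (intro sum_spaceI) auto
    then have "x - s \<in> U" unfolding weq by simp
    then have "x - s \<in> span (U \<union> X ` V)" by (intro span_base) simp
    moreover have "s \<in> span (U \<union> X ` V)"
      unfolding s_def using KV by (intro span_sum span_scale span_base) auto
    ultimately show ?thesis using span_add[of "x - s" "U \<union> X ` V" s] by simp
  qed
  moreover have "X ` V \<subseteq> A" using XA by auto
  ultimately have "cobasis U A (X ` V)" by (simp add: cobasis_def subset_iff)
  then have "codim U A = ecard (X ` V)" by (rule codim_eq[OF sU])
  also have "\<dots> = ecard V" using inj unfolding ecard_def by (simp add: card_image finite_image_iff)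
  finally show ?thesis unfolding V_def U_def A_def pers_codim_def by simp
qed

text \<open>Existence of a decomposition together with multiplicities that are the same for all of
  them makes the definite description \<open>Pers\<close> meaningful. Outside the index range no
  summand is permitted.\<close>

lemma Pers_eq_pers_codim:
  "Pers M (p, q) = (if lo \<le> p \<and> p \<le> q \<and> q \<le> hi then pers_codim f g p q else 0)"
proof -
  let ?D = "\<lambda>(p, q). if lo \<le> p \<and> p \<le> q \<and> q \<le> hi then pers_codim f g p q else 0"
  have D: "(\<lambda>pq. ecard {v. (pq, v) \<in> J}) = ?D" if J: "interval_decomposition M J" for J
  proof
    fix pq :: "nat \<times> nat"
    obtain p q where pq: "pq = (p, q)" by force
    show "ecard {v. (pq, v) \<in> J} = ?D pq"
    proof (cases "lo \<le> p \<and> p \<le> q \<and> q \<le> hi")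
      case True
      then show ?thesis using interval_decomposition_multiplicity[OF J] pq by simp
    next
      case False
      then have "{v. (pq, v) \<in> J} = {}"
        using J unfolding interval_decomposition_def first last pq by blast
      then show ?thesis using False by (auto simp: pq ecard_def zero_enat_def)
    qed
  qed
  obtain J where J: "interval_decomposition M J" using interval_decomposition_exists by blast
  have "Pers M = ?D"
    unfolding Pers_def
  proof (rule the_equality)
    show "\<exists>J. interval_decomposition M J \<and> ?D = (\<lambda>pq. ecard {v. (pq, v) \<in> J})"
      by (intro exI[of _ J] conjI J D[OF J, symmetric])
  qed (use D in auto)
  then show ?thesis by simp
qed

end

section \<open>Filtered chain complexes\<close>

text \<open>Chains of all degrees and stages live in one ambient space, as singular chains do, so
  every \<open>bd p\<close> is a linear map on that space and all flags can be intersected and added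
  there.\<close>

locale filtered_complex = field_space scale
  for scale :: "'a::field \<Rightarrow> 'b::ab_group_add \<Rightarrow> 'b" +
  fixes n :: nat and C :: "nat \<Rightarrow> int \<Rightarrow> 'b set" and bd :: "int \<Rightarrow> 'b \<Rightarrow> 'b"
  assumes n_pos: "1 \<le> n"
    and sC: "subspace (C i p)" and C_mono: "i \<le> j \<Longrightarrow> C i p \<subseteq> C j p" and C_0: "C 0 p = {0}"
    and bd_linear: "Vector_Spaces.linear scale scale (bd p)"
    and bd_C: "c \<in> C i p \<Longrightarrow> bd p c \<in> C i (p - 1)"
    and bd_bd: "bd p (bd (p + 1) c) = 0"
begin

lemma bd_add: "bd p (x + y) = bd p x + bd p y" and bd_diff: "bd p (x - y) = bd p x - bd p y"
  and bd_0: "bd p 0 = 0"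
  and subspace_bd_image: "subspace S \<Longrightarrow> subspace (bd p ` S)"
  and subspace_bd_vimage: "subspace S \<Longrightarrow> subspace {c. bd p c \<in> S}"
proof -
  interpret bd: Vector_Spaces.linear scale scale "bd p" by (rule bd_linear)
  show "bd p (x + y) = bd p x + bd p y" "bd p (x - y) = bd p x - bd p y" "bd p 0 = 0"
    by (simp_all add: bd.add bd.diff)
  show "subspace S \<Longrightarrow> subspace (bd p ` S)" by (rule bd.subspace_image)
  show "subspace S \<Longrightarrow> subspace {c. bd p c \<in> S}" by (rule bd.subspace_linear_preimage)
qed

lemma bd_C': "c \<in> C i (p + 1) \<Longrightarrow> bd (p + 1) c \<in> C i p"
  using bd_C[of c i "p + 1"] by simp

section \<open>Cycles and boundaries as pairs of flags\<close>

definition cycles :: "int \<Rightarrow> nat \<Rightarrow> 'b set" where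
  "cycles p i = {c \<in> C i p. bd p c = 0}"

definition boundaries :: "int \<Rightarrow> nat \<Rightarrow> 'b set" where
  "boundaries p i = bd (p + 1) ` C i (p + 1)"

definition rel_cycles :: "int \<Rightarrow> nat \<Rightarrow> 'b set" where
  "rel_cycles p i = {c \<in> C n p. bd p c \<in> C i (p - 1)}"

definition rel_boundaries :: "int \<Rightarrow> nat \<Rightarrow> 'b set" where
  "rel_boundaries p i = {c. \<exists>d\<in>C n (p + 1). bd (p + 1) d - c \<in> C i p}"

text \<open>The shift makes the space at index \<open>i\<close> begin with
  \<open>cycles p i\<close>. At the first index the flag is \<open>cycles p 0\<close>, which is
  trivial because stage 0 has no nonzero chains.\<close>

definition abs_f :: "int \<Rightarrow> nat \<Rightarrow> 'b set" where
  "abs_f p i = cycles p (i - 1)"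

text \<open>The value beyond \<open>n\<close> closes the flag: a class still alive at
  \<open>n\<close> is declared to die there, which produces the intervals
  \<open>[p, n]\<close>.\<close>

definition abs_g :: "int \<Rightarrow> nat \<Rightarrow> 'b set" where
  "abs_g p i = (if i \<le> n then boundaries p i else cycles p n)"

text \<open>The relative sequence begins at index 0 with all of \<open>cycles p n\<close>, so 0 has
  to be put before it by hand; its classes then count as born at 0.\<close>

definition rel_f :: "int \<Rightarrow> nat \<Rightarrow> 'b set" where
  "rel_f p i = (if i = 0 then {0} else rel_cycles p (i - 1))"

lemma subspace_cycles: "subspace (cycles p i)"
proof -
  have "cycles p i = C i p \<inter> {c. bd p c \<in> {0}}" by (auto simp: cycles_def)
  then show ?thesis using subspace_inter[OF sC subspace_bd_vimage[OF subspace_single_0]] by simp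
qed

lemma subspace_boundaries: "subspace (boundaries p i)"
  unfolding boundaries_def by (rule subspace_bd_image[OF sC])

lemma subspace_rel_cycles: "subspace (rel_cycles p i)"
proof -
  have "rel_cycles p i = C n p \<inter> {c. bd p c \<in> C i (p - 1)}" by (auto simp: rel_cycles_def)
  then show ?thesis using subspace_inter[OF sC subspace_bd_vimage[OF sC]] by simp
qed

text \<open>The defining condition says that \<open>c\<close> differs from a boundary by a chain of
  stage \<open>i\<close>. The sum form gives the subspace property and the splittings into boundary
  and chain used later.\<close>

lemma rel_boundaries_sum: "rel_boundaries p i = sum_space (boundaries p n) (C i p)"
proof (intro Set.set_eqI iffI)
  fix c assume "c \<in> rel_boundaries p i"
  then obtain d where d: "d \<in> C n (p + 1)" "bd (p + 1) d - c \<in> C i p"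
    unfolding rel_boundaries_def by blast
  have "- (bd (p + 1) d - c) \<in> C i p" using d(2) by (rule subspace_neg[OF sC])
  then have "bd (p + 1) d + - (bd (p + 1) d - c) \<in> sum_space (boundaries p n) (C i p)"
    using d(1) by (intro sum_spaceI) (auto simp: boundaries_def)
  then show "c \<in> sum_space (boundaries p n) (C i p)" by simp
next
  fix c assume "c \<in> sum_space (boundaries p n) (C i p)"
  then obtain d e where "d \<in> C n (p + 1)" "e \<in> C i p" "c = bd (p + 1) d + e"
    unfolding sum_space_def boundaries_def by blast
  then show "c \<in> rel_boundaries p i"
    unfolding rel_boundaries_def using subspace_neg[OF sC] by (intro CollectI bexI[of _ d]) auto
qed

lemma subspace_rel_boundaries: "subspace (rel_boundaries p i)"
  unfolding rel_boundaries_sum by (intro subspace_sum_space subspace_boundaries sC)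

lemma cycles_mono: "i \<le> j \<Longrightarrow> cycles p i \<subseteq> cycles p j"
  unfolding cycles_def using C_mono by blast

lemma boundaries_mono: "i \<le> j \<Longrightarrow> boundaries p i \<subseteq> boundaries p j"
  unfolding boundaries_def using C_mono by blast

lemma rel_cycles_mono: "i \<le> j \<Longrightarrow> rel_cycles p i \<subseteq> rel_cycles p j"
  unfolding rel_cycles_def using C_mono by blast

lemma rel_boundaries_mono: "i \<le> j \<Longrightarrow> rel_boundaries p i \<subseteq> rel_boundaries p j"
  unfolding rel_boundaries_def using C_mono by blast

lemma boundaries_cycles: "boundaries p i \<subseteq> cycles p i"
  unfolding boundaries_def cycles_def using bd_C' bd_bd by auto

lemma C_rel_boundaries: "C i p \<subseteq> rel_boundaries p i"
  unfolding rel_boundaries_sum by (rule sum_space_upper2[OF subspace_boundaries])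

lemma boundaries_rel_boundaries: "boundaries p n \<subseteq> rel_boundaries p i"
  unfolding rel_boundaries_sum by (rule sum_space_upper1[OF sC])

lemma rel_boundaries_rel_cycles: "i \<le> n \<Longrightarrow> rel_boundaries p i \<subseteq> rel_cycles p i"
  unfolding rel_boundaries_sum
proof (rule sum_space_least[OF subspace_rel_cycles])
  show "boundaries p n \<subseteq> rel_cycles p i"
    using boundaries_cycles[of p n] subspace_0[OF sC] unfolding cycles_def rel_cycles_def by auto
  show "i \<le> n \<Longrightarrow> C i p \<subseteq> rel_cycles p i"
    using C_mono[of i n p] bd_C unfolding rel_cycles_def by auto
qed

lemma rel_cycles_0: "rel_cycles p 0 = cycles p n"
  unfolding rel_cycles_def cycles_def C_0 by simp

lemma bd_rel_cycles: "x \<in> rel_cycles (p + 1) i \<Longrightarrow> bd (p + 1) x \<in> cycles p i"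
  unfolding rel_cycles_def cycles_def using bd_bd by simp

lemma bd_rel_boundaries:
  assumes "x \<in> rel_boundaries (p + 1) i" shows "bd (p + 1) x \<in> boundaries p i"
proof -
  obtain d e where "e \<in> C i (p + 1)" "x = bd (p + 1 + 1) d + e"
    using assms unfolding rel_boundaries_sum sum_space_def boundaries_def by blast
  then show ?thesis using bd_bd[of "p + 1" d] by (simp add: bd_add boundaries_def)
qed

lemma abs_flag_quotients:
  assumes "pm_first M = 1" "pm_last M = n"
    and "\<And>i. 1 \<le> i \<Longrightarrow> i \<le> n \<Longrightarrow> pm_space M i = quotient (cycles p i) (boundaries p i)"
    and "\<And>i A. 1 \<le> i \<Longrightarrow> i < n \<Longrightarrow>
      pm_map M i A = {a + b |a b. a \<in> A \<and> b \<in> boundaries p (Suc i)}"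
  shows "flag_quotients scale 1 n (abs_f p) (abs_g p) M"
proof unfold_locales
  \<comment> \<open>Monotonicity at the switch from boundaries to all cycles beyond
    \<open>n\<close>.\<close>
  have "boundaries p i \<subseteq> cycles p n" if "i \<le> n" for i
    using boundaries_cycles cycles_mono[OF that] by blast
  then show "mono (abs_g p)"
    unfolding abs_g_def by (intro monoI) (use boundaries_mono in auto)
  show "mono (abs_f p)" unfolding abs_f_def by (intro monoI cycles_mono) simp
  show "abs_f p 1 = {0}" using C_0 bd_0 by (auto simp: abs_f_def cycles_def)
  show "abs_g p i \<subseteq> abs_f p (Suc i)" if "1 \<le> i" "i \<le> n" for i
    using that boundaries_cycles by (simp add: abs_f_def abs_g_def)
qed (use assms in \<open>simp_all add: abs_f_def abs_g_def subspace_cycles subspace_boundaries\<close>)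

lemma rel_flag_quotients:
  assumes "pm_first M = 0" "pm_last M = n - 1"
    and "\<And>i. i < n \<Longrightarrow> pm_space M i = quotient (rel_cycles p i) (rel_boundaries p i)"
    and "\<And>i A. i < n - 1 \<Longrightarrow>
      pm_map M i A = {a + b |a b. a \<in> A \<and> b \<in> rel_boundaries p (Suc i)}"
  shows "flag_quotients scale 0 (n - 1) (rel_f p) (rel_boundaries p) M"
proof unfold_locales
  show "mono (rel_f p)"
    unfolding rel_f_def using subspace_0[OF subspace_rel_cycles]
    by (intro monoI) (use rel_cycles_mono[OF diff_le_mono] in auto)
  show "mono (rel_boundaries p)" by (intro monoI rel_boundaries_mono)
  \<comment> \<open>No closing value is needed on this side: every chain of stage \<open>n\<close>
    is a relative boundary at index \<open>n\<close>.\<close>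
  show "rel_f p (Suc (n - 1)) \<subseteq> rel_boundaries p (Suc (n - 1))"
    using n_pos C_rel_boundaries[of n p] by (auto simp: rel_f_def rel_cycles_def)
  show "rel_boundaries p i \<subseteq> rel_f p (Suc i)" if "0 \<le> i" "i \<le> n - 1" for i
    using that rel_boundaries_rel_cycles[of i p] by (simp add: rel_f_def)
qed (use assms n_pos in \<open>simp_all add: rel_f_def subspace_rel_cycles subspace_rel_boundaries\<close>)

text \<open>The boundary operator maps the relative piece onto the absolute one, and its kernel is
  harmless: a chain with boundary 0 is a relative cycle at every stage, in particular at
  \<open>p - 1\<close>. The bounds on \<open>p\<close> and \<open>q\<close> keep away from the
  artificial ends of the flags.\<close>

lemma pers_codim_finite:
  assumes pq: "1 \<le> p" "p \<le> q" "q < n"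
  shows "pers_codim (rel_f (k + 1)) (rel_boundaries (k + 1)) p q = pers_codim (abs_f k) (abs_g k) p q"
proof -
  have rf: "rel_f (k + 1) p = rel_cycles (k + 1) (p - 1)" "rel_f (k + 1) (Suc p) = rel_cycles (k + 1) p"
    using pq by (simp_all add: rel_f_def)
  have ag: "abs_g k q = boundaries k q" "abs_g k (Suc q) = boundaries k (Suc q)"
    using pq by (simp_all add: abs_g_def)
  note sub = subspace_inter subspace_sum_space subspace_cycles subspace_boundaries
    subspace_rel_cycles subspace_rel_boundaries
  \<comment> \<open>A chain of stage \<open>j\<close> is a relative boundary at \<open>j\<close>,
    and it is a relative cycle at \<open>i\<close> as soon as its boundary lies in stage
    \<open>i\<close>. So one preimage satisfies both conditions.\<close>
  have lift: "\<exists>b. b \<in> rel_cycles (k + 1) i \<inter> rel_boundaries (k + 1) j \<and> bd (k + 1) b = y"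
    if y: "y \<in> cycles k i \<inter> boundaries k j" and j: "j \<le> n" for y i j
  proof -
    obtain b where b: "b \<in> C j (k + 1)" "y = bd (k + 1) b" using y unfolding boundaries_def by blast
    have "b \<in> rel_cycles (k + 1) i"
      using b y C_mono[OF j] unfolding rel_cycles_def cycles_def by auto
    then show ?thesis using b C_rel_boundaries by blast
  qed
  show ?thesis
    unfolding pers_codim_def rf ag abs_f_def diff_Suc_1
  proof (rule codim_transport[OF bd_linear[of "k + 1"]])
    fix x assume x: "x \<in> rel_cycles (k + 1) p \<inter> rel_boundaries (k + 1) (Suc q)"
    show "bd (k + 1) x \<in> cycles k p \<inter> boundaries k (Suc q)"
      using x bd_rel_cycles bd_rel_boundaries by blast
    show "bd (k + 1) x \<in> sum_space (cycles k (p - 1) \<inter> boundaries k (Suc q)) (cycles k p \<inter> boundaries k q)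
      \<longleftrightarrow> x \<in> sum_space (rel_cycles (k + 1) (p - 1) \<inter> rel_boundaries (k + 1) (Suc q))
          (rel_cycles (k + 1) p \<inter> rel_boundaries (k + 1) q)" (is "?l \<longleftrightarrow> ?r")
    proof
      assume ?r
      then obtain y z where "x = y + z" "y \<in> rel_cycles (k + 1) (p - 1) \<inter> rel_boundaries (k + 1) (Suc q)"
        "z \<in> rel_cycles (k + 1) p \<inter> rel_boundaries (k + 1) q"
        unfolding sum_space_def by blast
      then show ?l
        unfolding \<open>x = y + z\<close> bd_add using bd_rel_cycles bd_rel_boundaries by (intro sum_spaceI) auto
    next
      assume ?l
      then obtain u w where uw: "bd (k + 1) x = u + w"
        "u \<in> cycles k (p - 1) \<inter> boundaries k (Suc q)" "w \<in> cycles k p \<inter> boundaries k q"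
        unfolding sum_space_def by blast
      obtain b where b: "b \<in> rel_cycles (k + 1) (p - 1) \<inter> rel_boundaries (k + 1) (Suc q)"
        "bd (k + 1) b = u" using lift[OF uw(2)] pq by auto
      obtain c where c: "c \<in> rel_cycles (k + 1) p \<inter> rel_boundaries (k + 1) q"
        "bd (k + 1) c = w" using lift[OF uw(3)] pq by auto
      have bc: "b \<in> C n (k + 1)" "c \<in> C n (k + 1)" "x \<in> C n (k + 1)"
        using b c x unfolding rel_cycles_def by auto
      have c': "c \<in> rel_boundaries (k + 1) (Suc q)" using c rel_boundaries_mono[of q "Suc q"] by auto
      \<comment> \<open>Since \<open>u\<close> lies in stage \<open>p - 1\<close>, the difference
        \<open>x - c\<close> is a relative cycle there, which takes care of the kernel.\<close>
      have "bd (k + 1) (x - c) = u" using uw(1) c by (simp add: bd_diff)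
      moreover have "x - c \<in> C n (k + 1)" using subspace_diff[OF sC] bc by blast
      moreover have "u \<in> C (p - 1) k" using uw(2) unfolding cycles_def by simp
      ultimately have "x - c \<in> rel_cycles (k + 1) (p - 1)" unfolding rel_cycles_def by simp
      moreover have "x - c \<in> rel_boundaries (k + 1) (Suc q)"
        using subspace_diff[OF subspace_rel_boundaries] x c' by blast
      ultimately have "(x - c) + c \<in> sum_space (rel_cycles (k + 1) (p - 1) \<inter> rel_boundaries (k + 1) (Suc q))
          (rel_cycles (k + 1) p \<inter> rel_boundaries (k + 1) q)"
        using c by (intro sum_spaceI) auto
      then show ?r by simp
    qed
  next
    fix y assume y: "y \<in> cycles k p \<inter> boundaries k (Suc q)"
    obtain b where b: "b \<in> rel_cycles (k + 1) p \<inter> rel_boundaries (k + 1) (Suc q)" "bd (k + 1) b = y"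
      using lift[OF y] pq by auto
    show "\<exists>x\<in>rel_cycles (k + 1) p \<inter> rel_boundaries (k + 1) (Suc q). y - bd (k + 1) x
        \<in> sum_space (cycles k (p - 1) \<inter> boundaries k (Suc q)) (cycles k p \<inter> boundaries k q)"
      using b by (intro bexI[of _ b]) (simp_all add: subspace_0 sub)
  next
    show "sum_space (rel_cycles (k + 1) (p - 1) \<inter> rel_boundaries (k + 1) (Suc q))
          (rel_cycles (k + 1) p \<inter> rel_boundaries (k + 1) q)
        \<subseteq> rel_cycles (k + 1) p \<inter> rel_boundaries (k + 1) (Suc q)"
      using rel_cycles_mono[of "p - 1" p] rel_boundaries_mono[of q "Suc q"]
      by (intro sum_space_least sub) auto
  qed (intro sub)+
qed

text \<open>At the ends of the flags one intersection or summand degenerates on each side. What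
  remains is an isomorphism induced by inclusion: in a cycle written as boundary plus chain of stage
  \<open>i\<close>, that chain is itself a cycle.\<close>

lemma pers_codim_infinite:
  assumes p: "1 \<le> p" "p \<le> n"
  shows "pers_codim (abs_f k) (abs_g k) p n = pers_codim (rel_f k) (rel_boundaries k) 0 (p - 1)"
proof -
  note sub = subspace_inter subspace_sum_space subspace_cycles subspace_boundaries
    subspace_rel_cycles subspace_rel_boundaries subspace_single_0
  have ag: "abs_g k (Suc n) = cycles k n" "abs_g k n = boundaries k n" by (simp_all add: abs_g_def)
  have rf: "rel_f k 0 = {0}" "rel_f k (Suc 0) = cycles k n" by (simp_all add: rel_f_def rel_cycles_0)
  have cyc: "cycles k (p - 1) \<inter> cycles k n = cycles k (p - 1)" "cycles k p \<inter> cycles k n = cycles k p"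
    using cycles_mono[OF le_trans[OF diff_le_self p(2)], of k] cycles_mono[OF p(2), of k] by auto
  have [simp]: "Suc (p - 1) = p" using p by simp
  have zero: "{0} \<inter> rel_boundaries k p = {0}" using subspace_0[OF subspace_rel_boundaries] by auto
  have sum0: "sum_space {0} W = W" for W unfolding sum_space_def by auto
  show ?thesis
    unfolding pers_codim_def ag rf abs_f_def diff_Suc_1 cyc \<open>Suc (p - 1) = p\<close> zero sum0
  proof (rule codim_transport[OF linear_ident])
    fix x assume x: "x \<in> cycles k p"
    then have xn: "x \<in> cycles k n" using cycles_mono[OF p(2)] by blast
    show "x \<in> cycles k n \<inter> rel_boundaries k p"
      using x xn C_rel_boundaries[of p k] unfolding cycles_def by auto
    show "x \<in> cycles k n \<inter> rel_boundaries k (p - 1)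
      \<longleftrightarrow> x \<in> sum_space (cycles k (p - 1)) (cycles k p \<inter> boundaries k n)"
    proof
      assume "x \<in> sum_space (cycles k (p - 1)) (cycles k p \<inter> boundaries k n)"
      moreover have "sum_space (cycles k (p - 1)) (cycles k p \<inter> boundaries k n) \<subseteq> rel_boundaries k (p - 1)"
        using C_rel_boundaries[of "p - 1" k] boundaries_rel_boundaries
        by (intro sum_space_least sub) (auto simp: cycles_def)
      ultimately show "x \<in> cycles k n \<inter> rel_boundaries k (p - 1)" using xn by blast
    next
      assume "x \<in> cycles k n \<inter> rel_boundaries k (p - 1)"
      then obtain b e where be: "x = b + e" "b \<in> boundaries k n" "e \<in> C (p - 1) k"
        unfolding rel_boundaries_sum sum_space_def by blast
      \<comment> \<open>Both \<open>x\<close> and the boundary \<open>b\<close> are cycles, hence so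
        is their difference \<open>e\<close>.\<close>
      have e: "e \<in> cycles k (p - 1)"
        using be boundaries_cycles[of k n] x unfolding cycles_def by (auto simp: bd_add)
      then have "e \<in> cycles k p" using cycles_mono[of "p - 1" p] by auto
      then have "x - e \<in> cycles k p" using x subspace_diff[OF subspace_cycles] by blast
      then have "e + b \<in> sum_space (cycles k (p - 1)) (cycles k p \<inter> boundaries k n)"
        using e be by (intro sum_spaceI) auto
      then show "x \<in> sum_space (cycles k (p - 1)) (cycles k p \<inter> boundaries k n)"
        using be(1) by (simp add: add.commute)
    qed
  next
    fix y assume y: "y \<in> cycles k n \<inter> rel_boundaries k p"
    then obtain b e where be: "y = b + e" "b \<in> boundaries k n" "e \<in> C p k"
      unfolding rel_boundaries_sum sum_space_def by blast
    have b: "b \<in> cycles k n" using be boundaries_cycles by blast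
    have "e \<in> cycles k p" using be y b unfolding cycles_def by (auto simp: bd_add)
    moreover have "y - e \<in> cycles k n \<inter> rel_boundaries k (p - 1)"
      using be b boundaries_rel_boundaries by auto
    ultimately show "\<exists>x\<in>cycles k p. y - x \<in> cycles k n \<inter> rel_boundaries k (p - 1)" by blast
  next
    show "sum_space (cycles k (p - 1)) (cycles k p \<inter> boundaries k n) \<subseteq> cycles k p"
      using cycles_mono[of "p - 1" p] by (intro sum_space_least sub) auto
  qed (intro sub)+
qed

end

section \<open>Singular chains with field coefficients\<close>

lemma lookup_kchain_scale [simp]:
  "Poly_Mapping.lookup (kchain_scale r c) x = r * Poly_Mapping.lookup c x"
  unfolding kchain_scale_def by (simp add: Poly_Mapping.map.rep_eq when_def)

interpretation kchain: field_space "kchain_scale :: 'k::field \<Rightarrow> ('a, 'k) kchain \<Rightarrow> ('a, 'k) kchain"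
  by unfold_locales (auto intro!: poly_mapping_eqI simp: lookup_add algebra_simps)

lemma khomology_quotient:
  "khomology p X S = kchain.quotient (krelcycles p X S) (krelboundaries p X S)"
  unfolding khomology_def kchain.quotient_def kchain.coset_def[abs_def] ..

lemma kchains_iff:
  "c \<in> kchains p X \<longleftrightarrow>
     (\<forall>s. Poly_Mapping.lookup c s \<noteq> 0 \<longrightarrow> 0 \<le> p \<and> singular_simplex (nat p) X s)"
  unfolding kchains_def by (auto simp: subset_iff in_keys_iff split: if_splits)

lemma subspace_kchains: "kchain.subspace (kchains p X)"
  by (rule kchain.subspaceI) (auto simp: kchains_iff lookup_add, metis add_0)+

lemma kchains_single:
  "0 \<le> p \<Longrightarrow> singular_simplex (nat p) X s \<Longrightarrow> Poly_Mapping.single s a \<in> kchains p X"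
  by (auto simp: kchains_iff lookup_single when_def)

lemma kchains_mono: "S \<subseteq> S' \<Longrightarrow> kchains p (subtopology T S) \<subseteq> kchains p (subtopology T S')"
  by (fastforce simp: kchains_iff singular_simplex_subtopology)

text \<open>Used twice: it makes stage 0 trivial, and it turns homology relative to
  \<open>{}\<close> into absolute homology.\<close>

lemma kchains_empty: "kchains p trivial_topology = {0}"
  by (auto simp: kchains_iff singular_simplex_empty intro!: poly_mapping_eqI)

text \<open>Lets boundaries of chains with different supports be written as sums over a common index
  set, as linearity requires.\<close>

lemma kboundary_superset:
  assumes "finite S" "Poly_Mapping.keys c \<subseteq> S" "0 < p"
  shows "kboundary p c = (\<Sum>s\<in>S. \<Sum>j\<le>nat p.
    Poly_Mapping.single (singular_face (nat p) j s) ((-1) ^ j * Poly_Mapping.lookup c s))"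
  using assms unfolding kboundary_def
  by (auto intro!: sum.mono_neutral_left simp: in_keys_iff)

lemma linear_kboundary:
  "Vector_Spaces.linear kchain_scale kchain_scale
     (kboundary p :: ('a, 'k::field) kchain \<Rightarrow> ('a, 'k) kchain)"
proof (cases "0 < p")
  case True
  have "kboundary p (x + y) = kboundary p x + kboundary p y" for x y :: "('a, 'k) kchain"
  proof -
    let ?S = "Poly_Mapping.keys x \<union> Poly_Mapping.keys y"
    have "kboundary p z = (\<Sum>s\<in>?S. \<Sum>j\<le>nat p.
      Poly_Mapping.single (singular_face (nat p) j s) ((-1) ^ j * Poly_Mapping.lookup z s))"
      if "Poly_Mapping.keys z \<subseteq> ?S" for z
      using that True by (intro kboundary_superset) auto
    from this[OF Poly_Mapping.keys_add] this[of x] this[of y] show ?thesis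
      by (simp add: lookup_add distrib_left single_add sum.distrib)
  qed
  moreover have "kboundary p (kchain_scale r x) = kchain_scale r (kboundary p x)"
    for r and x :: "('a, 'k) kchain"
  proof -
    have "Poly_Mapping.keys (kchain_scale r x) \<subseteq> Poly_Mapping.keys x" by (auto simp: in_keys_iff)
    then have "kboundary p (kchain_scale r x) = (\<Sum>s\<in>Poly_Mapping.keys x. \<Sum>j\<le>nat p.
        Poly_Mapping.single (singular_face (nat p) j s) (r * ((-1) ^ j * Poly_Mapping.lookup x s)))"
      using True by (subst kboundary_superset[of "Poly_Mapping.keys x"]) (auto simp: mult.left_commute)
    moreover have "Poly_Mapping.single s (r * t) = kchain_scale r (Poly_Mapping.single s t)"
      for s :: "(nat \<Rightarrow> real) \<Rightarrow> 'a" and t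
      by (rule poly_mapping_eqI) (simp add: lookup_single when_def)
    ultimately show ?thesis
      using True by (simp add: kchain.scale_sum_right kboundary_def)
  qed
  ultimately show ?thesis
    unfolding Vector_Spaces.linear_iff using kchain.vector_space_axioms by blast
next
  case False
  then have "kboundary p = (\<lambda>_ :: ('a, 'k) kchain. 0)" by (auto simp: kboundary_def)
  then show ?thesis
    unfolding Vector_Spaces.linear_iff
    by (simp add: kchain.vector_space_axioms kchain.scale_zero_right)
qed

lemma kboundary_single:
  "0 < p \<Longrightarrow> kboundary p (Poly_Mapping.single s a) =
     (\<Sum>j\<le>nat p. Poly_Mapping.single (singular_face (nat p) j s) ((-1) ^ j * a))"
  by (subst kboundary_superset[of "{s}"]) auto

lemma kboundary_in_kchains:
  assumes c: "c \<in> kchains p X" shows "kboundary p c \<in> kchains (p - 1) X"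
proof (cases "0 < p")
  case True
  have "singular_simplex (nat (p - 1)) X (singular_face (nat p) j s)"
    if "s \<in> Poly_Mapping.keys c" "j \<le> nat p" for s j
    using singular_simplex_singular_face[of "nat p" X s j] c that True
    by (auto simp: kchains_iff in_keys_iff nat_diff_distrib)
  then show ?thesis
    using True unfolding kboundary_def
    by (auto intro!: kchain.subspace_sum[OF subspace_kchains] kchains_single)
next
  case False
  then show ?thesis by (simp add: kboundary_def kchain.subspace_0[OF subspace_kchains])
qed

text \<open>The simplicial identity for faces, inherited from the one for the coface maps
  \<open>simplical_face\<close>; off the simplex both sides are undefined alike.\<close>

lemma singular_face_singular_face:
  assumes "i \<le> j" "j \<le> p - Suc 0" "2 \<le> p"
  shows "singular_face (p - Suc 0) i (singular_face p (Suc j) s) =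
    singular_face (p - Suc 0) j (singular_face p i s)"
proof
  fix t
  show "singular_face (p - Suc 0) i (singular_face p (Suc j) s) t =
    singular_face (p - Suc 0) j (singular_face p i s) t"
  proof (cases "t \<in> standard_simplex (p - Suc 0 - Suc 0)")
    case True
    have "simplical_face i t \<in> standard_simplex (p - Suc 0)"
      "simplical_face j t \<in> standard_simplex (p - Suc 0)"
      using True assms by (auto intro!: simplical_face_in_standard_simplex)
    moreover have "simplical_face (Suc j) (simplical_face i t) = simplical_face i (simplical_face j t)"
      using assms(1) unfolding simplical_face_def by fastforce
    ultimately show ?thesis by (simp add: singular_face_def)
  qed (simp add: singular_face_def)
qed

lemma kboundary_kboundary:
  fixes c :: "('a, 'k::field) kchain"
  shows "kboundary p (kboundary (p + 1) c) = 0"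
proof (cases "0 < p")
  case True
  interpret bd: Vector_Spaces.linear kchain_scale kchain_scale
    "kboundary p :: ('a, 'k) kchain \<Rightarrow> ('a, 'k) kchain" by (rule linear_kboundary)
  define m where "m = nat p"
  have m: "nat (p + 1) = Suc m" "1 \<le> m" using True unfolding m_def by auto
  have "kboundary p (\<Sum>x\<le>Suc m. Poly_Mapping.single (singular_face (Suc m) x s) ((-1) ^ x * a)) = 0"
    for s :: "(nat \<Rightarrow> real) \<Rightarrow> 'a" and a :: 'k
  proof -
    define D where "D = (\<lambda>(x, y). Poly_Mapping.single
      (singular_face m y (singular_face (Suc m) x s)) ((-1) ^ (x + y) * a))"
    let ?A = "{(x, y). x \<le> Suc m \<and> y \<le> m \<and> y < x}" and ?B = "{(x, y). x \<le> y \<and> y \<le> m}"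
    have dis: "?A \<inter> ?B = {}" by auto
    have fin: "finite ?A" "finite ?B"
      by (rule finite_subset[of _ "{..Suc m} \<times> {..m}"]; auto)+
    have "kboundary p (\<Sum>x\<le>Suc m. Poly_Mapping.single (singular_face (Suc m) x s) ((-1) ^ x * a))
        = (\<Sum>x\<le>Suc m. \<Sum>y\<le>m. D (x, y))"
    proof -
      have sgn: "(-1) ^ y * ((-1) ^ x * a) = (-1) ^ (x + y) * a" for x y :: nat
        unfolding power_add by (simp only: mult.assoc mult.left_commute)
      show ?thesis
        unfolding bd.sum kboundary_single[OF True] m_def[symmetric] sgn D_def by simp
    qed
    also have "\<dots> = sum D ({..Suc m} \<times> {..m})" by (simp add: sum.cartesian_product)
    also have "{..Suc m} \<times> {..m} = ?A \<union> ?B" by auto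
    also have "sum D (?A \<union> ?B) = sum D ?A + sum D ?B" by (rule sum.union_disjoint[OF fin dis])
    \<comment> \<open>Sending \<open>(x, y)\<close> with \<open>y < x\<close> to
      \<open>(y, x - 1)\<close> preserves the iterated face and lowers the sum of the indices by
      one, which flips the sign.\<close>
    also have "sum D ?A = (\<Sum>z\<in>?B. - D z)"
    proof (rule sum.reindex_bij_witness[where i = "\<lambda>(x, y). (Suc y, x)" and j = "\<lambda>(x, y). (y, x - 1)"])
      fix z assume "z \<in> ?A"
      then obtain x y where z: "z = (Suc x, y)" "y \<le> x" "x \<le> m" by (cases z; cases "fst z") auto
      have "singular_face m y (singular_face (Suc m) (Suc x) s) = singular_face m x (singular_face (Suc m) y s)"
        using singular_face_singular_face[of y x "Suc m" s] z m by simp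
      then show "- D (case z of (x, y) \<Rightarrow> (y, x - 1)) = D z"
        using z(1) by (simp add: D_def add.commute single_uminus)
    qed auto
    finally show ?thesis by (simp add: sum_negf)
  qed
  then show ?thesis
    using True by (simp add: kboundary_def[of "p + 1"] m bd.sum del: sum.atMost_Suc)
qed (simp add: kboundary_def)

text \<open>The locale wants monotonicity at all indices, while \<open>X\<close> is controlled only
  up to \<open>n\<close>; \<open>min i n\<close> makes the filtration constant from there
  on.\<close>

lemma filtered_complex_kchains:
  assumes "1 \<le> n" "X 0 = {}" "\<And>i j. i \<le> j \<Longrightarrow> j \<le> n \<Longrightarrow> X i \<subseteq> X j"
  shows "filtered_complex (kchain_scale :: 'k::field \<Rightarrow> ('a, 'k) kchain \<Rightarrow> ('a, 'k) kchain) n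
    (\<lambda>i p. kchains p (subtopology T (X (min i n)))) kboundary"
proof unfold_locales
  show "kchains p (subtopology T (X (min i n))) \<subseteq> kchains p (subtopology T (X (min j n)))"
    if "i \<le> j" for i j p
    by (intro kchains_mono assms) (use that in auto)
  show "kchains p (subtopology T (X (min 0 n))) = {0}" for p
    by (simp add: assms(2) kchains_empty)
  show "kboundary p c \<in> kchains (p - 1) (subtopology T (X (min i n)))"
    if "c \<in> kchains p (subtopology T (X (min i n)))" for c :: "('a, 'k) kchain" and i p
    using that by (rule kboundary_in_kchains)
qed (use assms(1) in \<open>simp_all add: subspace_kchains kboundary_kboundary
    linear_kboundary[unfolded Vector_Spaces.linear_iff]\<close>)

text \<open>The complete comparison in terms of index pairs: supports, finite intervals, infinite
  intervals. The real values enter only afterwards.\<close>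

lemma Pers_abs_rel:
  fixes T :: "'a topology" and X :: "nat \<Rightarrow> 'a set"
  assumes n: "1 \<le> n" and X0: "X 0 = {}" and X: "\<And>i j. i \<le> j \<Longrightarrow> j \<le> n \<Longrightarrow> X i \<subseteq> X j"
  defines "H \<equiv> abs_persistence TYPE('k::field) T n X"
    and "Hrel \<equiv> rel_persistence TYPE('k) T n X"
  shows "Pers (H k) (p, q) = 0 \<or> 1 \<le> p \<and> p \<le> q \<and> q \<le> n"
    and "Pers (Hrel k) (p, q) = 0 \<or> p \<le> q \<and> q \<le> n - 1"
    and "1 \<le> p \<Longrightarrow> q < n \<Longrightarrow> Pers (Hrel (k + 1)) (p, q) = Pers (H k) (p, q)"
    and "1 \<le> p \<Longrightarrow> p \<le> n \<Longrightarrow> Pers (H k) (p, n) = Pers (Hrel k) (0, p - 1)"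
proof -
  define C :: "nat \<Rightarrow> int \<Rightarrow> ('a, 'k) kchain set"
    where "C i p = kchains p (subtopology T (X (min i n)))" for i p
  interpret C: filtered_complex "kchain_scale :: 'k \<Rightarrow> ('a, 'k) kchain \<Rightarrow> ('a, 'k) kchain" n C kboundary
    unfolding C_def[abs_def] by (rule filtered_complex_kchains[of n X, OF n X0 X])
  have abs_cyc: "krelcycles k (subtopology T (X i)) {} = C.cycles k i"
    and abs_bd: "krelboundaries k (subtopology T (X i)) {} = C.boundaries k i" if "i \<le> n" for k i
    using that unfolding krelcycles_def krelboundaries_def C.cycles_def C.boundaries_def C_def
    by (auto simp: kchains_empty min_def)
  have nn: "X n \<inter> X i = X i" if "i \<le> n" for i using X[OF that] by auto
  have rel_cyc: "krelcycles k (subtopology T (X n)) (X i) = C.rel_cycles k i"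
    and rel_bd: "krelboundaries k (subtopology T (X n)) (X i) = C.rel_boundaries k i" if "i \<le> n" for k i
    using that unfolding krelcycles_def krelboundaries_def C.rel_cycles_def C.rel_boundaries_def C_def
    by (auto simp: subtopology_subtopology nn min_def)
  have A: "flag_quotients kchain_scale 1 n (C.abs_f k) (C.abs_g k) (H k)" for k
    by (rule C.abs_flag_quotients)
      (simp_all add: H_def abs_persistence_def khomology_quotient abs_cyc abs_bd khom_inclusion_def)
  have R: "flag_quotients kchain_scale 0 (n - 1) (C.rel_f k) (C.rel_boundaries k) (Hrel k)" for k
    by (rule C.rel_flag_quotients)
      (simp_all add: Hrel_def rel_persistence_def khomology_quotient rel_cyc rel_bd khom_inclusion_def)
  note PA = flag_quotients.Pers_eq_pers_codim[OF A] and PR = flag_quotients.Pers_eq_pers_codim[OF R]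
  show "Pers (H k) (p, q) = 0 \<or> 1 \<le> p \<and> p \<le> q \<and> q \<le> n" by (simp add: PA)
  show "Pers (Hrel k) (p, q) = 0 \<or> p \<le> q \<and> q \<le> n - 1" by (simp add: PR)
  show "Pers (Hrel (k + 1)) (p, q) = Pers (H k) (p, q)" if "1 \<le> p" "q < n"
    using that by (auto simp: PA PR C.pers_codim_finite)
  show "Pers (H k) (p, n) = Pers (Hrel k) (0, p - 1)" if "1 \<le> p" "p \<le> n"
    using that by (auto simp: PA PR C.pers_codim_infinite)
qed

text \<open>Different index pairs may yield the same real interval when values of \<open>a\<close>
  repeat, so multiplicities add up. Here the sum is reparametrized by a set \<open>P\<close>
  covering the support, later the birth indices \<open>{1..n}\<close>.\<close>

lemma intervals_supported:
  assumes inj: "inj_on \<iota> P" and P: "finite P"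
    and range: "\<And>p. p \<in> P \<Longrightarrow> fst (\<iota> p) \<le> snd (\<iota> p) \<and> snd (\<iota> p) \<le> n"
    and supp: "\<And>pq. D pq \<noteq> 0 \<Longrightarrow> pq \<in> \<iota> ` P"
  shows "intervals n a D I = (\<Sum>p\<in>{p\<in>P. interval_of n a (\<iota> p) = I}. D (\<iota> p))"
proof -
  let ?S = "{pq. fst pq \<le> snd pq \<and> snd pq \<le> n \<and> interval_of n a pq = I}"
  have "finite ?S" by (rule finite_subset[of _ "{..n} \<times> {..n}"]) auto
  then have "intervals n a D I = sum D (\<iota> ` {p\<in>P. interval_of n a (\<iota> p) = I})"
    unfolding intervals_def
    by (intro sum.mono_neutral_right) (use range supp in \<open>blast+\<close>)
  also have "\<dots> = (\<Sum>p\<in>{p\<in>P. interval_of n a (\<iota> p) = I}. D (\<iota> p))"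
    by (rule sum.reindex[unfolded o_def]) (rule inj_on_subset[OF inj], auto)
  finally show ?thesis .
qed

theorem proposition2p4:
  fixes T :: "'a topology" and n :: nat and X :: "nat \<Rightarrow> 'a set"
    and a :: "nat \<Rightarrow> real" and k :: int
  assumes "filtered_cell_complex T n X"
    and "mono_on {1..n} a"
  defines "H \<equiv> abs_persistence TYPE('k::field) T n X"
    and "Hrel \<equiv> rel_persistence TYPE('k) T n X"
  shows "Pers_0 n a (H k) = Pers_0 n a (Hrel (k + 1)) \<and>
         intervals n a (Pers_0 n a (H k)) = intervals n a (Pers_0 n a (Hrel (k + 1))) \<and>
         emultiset_bij (\<lambda>(p, q). (0, p - 1)) (Pers_inf n a (H k)) (Pers_inf n a (Hrel k)) \<and>
         emultiset_bij (\<lambda>(b, d). (-\<infinity>, b))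
           (intervals n a (Pers_inf n a (H k))) (intervals n a (Pers_inf n a (Hrel k)))"
proof -
  have n: "1 \<le> n" and X0: "X 0 = {}" and step: "\<And>i. i \<in> {1..n} \<Longrightarrow> X (i - 1) \<subseteq> X i"
    using assms(1) unfolding filtered_cell_complex_def by auto
  have X: "X i \<subseteq> X j" if "i \<le> j" "j \<le> n" for i j
    using that
  proof (induction j rule: dec_induct)
    case (step j)
    then show ?case using \<open>\<And>i. i \<in> {1..n} \<Longrightarrow> X (i - 1) \<subseteq> X i\<close>[of "Suc j"] by auto
  qed simp
  note PR = Pers_abs_rel[where n = n and X = X and T = T and 'k = 'k, OF n X0 X, folded H_def Hrel_def]
  have fin: "finite_interval (interval_of n a (p, q)) \<longleftrightarrow> 1 \<le> p \<and> p \<le> n \<and> q < n" for p q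
    by (auto simp: finite_interval_def interval_of_def index_value_def)
  have eq0: "Pers_0 n a (H k) = Pers_0 n a (Hrel (k + 1))"
  proof
    fix pq :: "nat \<times> nat"
    show "Pers_0 n a (H k) pq = Pers_0 n a (Hrel (k + 1)) pq"
      using PR(3)[of "fst pq" "snd pq" k] by (cases pq) (auto simp: Pers_0_def fin)
  qed
  define D where "D = Pers_inf n a (H k)"
  define E where "E = Pers_inf n a (Hrel k)"
  have D: "D pq \<noteq> 0 \<Longrightarrow> pq \<in> (\<lambda>p. (p, n)) ` {1..n}" for pq
    using PR(1)[of k "fst pq" "snd pq"]
    by (cases pq) (auto simp: D_def Pers_inf_def fin split: if_splits)
  have E: "E pq \<noteq> 0 \<Longrightarrow> pq \<in> (\<lambda>p. (0, p - 1)) ` {1..n}" for pq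
    using PR(2)[of k "fst pq" "snd pq"] n
    by (cases pq) (auto simp: E_def Pers_inf_def fin image_iff split: if_splits
        intro!: bexI[of _ "Suc (snd pq)"])
  have DE: "E (0, p - 1) = D (p, n)" if "p \<in> {1..n}" for p
    using that PR(4)[of p k] by (simp add: D_def E_def Pers_inf_def fin)
  have bij: "emultiset_bij (\<lambda>(p, q). (0, p - 1)) D E"
    unfolding emultiset_bij_def
  \<comment> \<open>The inverse sends \<open>[0, q]\<close> to \<open>[q + 1, n]\<close>; on the
    supports, \<open>Suc (p - 1) = p\<close> because births occur at
    \<open>p \<ge> 1\<close>.\<close>
  proof (intro conjI allI impI bij_betw_byWitness[where f' = "\<lambda>(p, q). (Suc q, n)"])
    show "(\<lambda>(p, q). (0, p - 1)) ` {x. D x \<noteq> 0} \<subseteq> {y. E y \<noteq> 0}"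
      using D DE by fastforce
    show "(\<lambda>(p, q). (Suc q, n)) ` {y. E y \<noteq> 0} \<subseteq> {x. D x \<noteq> 0}"
      using E DE by fastforce
    show "E (case x of (p, q) \<Rightarrow> (0, p - 1)) = D x" if "D x \<noteq> 0" for x
      using D[OF that] DE by auto
  qed (use D E in fastforce)+
  \<comment> \<open>The common multiplicity of \<open>[b, \<infinity>)\<close> and
    \<open>[-\<infinity>, b)\<close>, added up over all indices with value \<open>b\<close>.\<close>
  define s where "s b = (\<Sum>p\<in>{p\<in>{1..n}. ereal (a p) = b}. D (p, n))" for b
  have iD: "intervals n a D (b, d) = (if d = \<infinity> then s b else 0)" for b d
  proof -
    have "intervals n a D (b, d) = (\<Sum>p\<in>{p\<in>{1..n}. interval_of n a (p, n) = (b, d)}. D (p, n))"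
      by (rule intervals_supported) (use D in \<open>auto simp: inj_on_def\<close>)
    moreover have "{p\<in>{1..n}. interval_of n a (p, n) = (b, d)} =
        (if d = \<infinity> then {p\<in>{1..n}. ereal (a p) = b} else {})"
      by (auto simp: interval_of_def index_value_def)
    ultimately show ?thesis by (simp add: s_def)
  qed
  \<comment> \<open>The pair \<open>[0, p - 1]\<close> has right endpoint at index
    \<open>(p - 1) + 1 = p\<close>, so it gives the value \<open>a p\<close> at which
    \<open>[p, n]\<close> starts.\<close>
  have iE: "intervals n a E (z, b) = (if z = -\<infinity> then s b else 0)" for z b
  proof -
    have "intervals n a E (z, b) = (\<Sum>p\<in>{p\<in>{1..n}. interval_of n a (0, p - 1) = (z, b)}. E (0, p - 1))"
      by (rule intervals_supported) (use E in \<open>auto simp: inj_on_def\<close>)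
    moreover have "{p\<in>{1..n}. interval_of n a (0, p - 1) = (z, b)} =
        (if z = -\<infinity> then {p\<in>{1..n}. ereal (a p) = b} else {})"
      by (auto simp: interval_of_def index_value_def)
    moreover have "(\<Sum>p\<in>{p\<in>{1..n}. ereal (a p) = b}. E (0, p - 1)) = s b"
      unfolding s_def by (rule sum.cong) (use DE in auto)
    ultimately show ?thesis by simp
  qed
  have "emultiset_bij (\<lambda>(b, d). (-\<infinity>, b)) (intervals n a D) (intervals n a E)"
    unfolding emultiset_bij_def
  proof (intro conjI allI impI bij_betw_byWitness[where f' = "\<lambda>(z, b). (b, \<infinity>)"])
  qed (auto simp: iD iE split: if_splits)
  then show ?thesis using eq0 bij unfolding D_def E_def by simp
qed

end
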